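(* Let $I\subset\mathbb{R}$ be an open interval, let $\gamma:I\to\mathbb{R}^2$ be a frontal with Gauss mapping $\nu:I\to S^1$, moving frame $\{\nu,\mu\}$ and curvature $(l,\beta)$, and let $\lambda:I\to\mathbb{R}_+$ be a positive $C^\infty$ function. Then the following hold. (1) Suppose that the circle family $\mathcal{C}_{(\gamma,\lambda)}$ creates an envelope $f:I\to\mathbb{R}^2$, with creator $\widetilde{\nu}=-\cos\theta\,\mu\pm\sin\theta\,\nu$, where $\theta:I\to\mathbb{R}$ is $C^\infty$ and $\frac{d\lambda}{dt}=\cos\theta\,\beta$. Then $f$ is a frontal with Gauss mapping $\widetilde{\nu}:I\to S^1$, and its curvature is $$\big(l(t)\pm\dot\theta(t),\ \lambda(t)[l(t)\pm\dot\theta(t)]\pm\beta(t)\sin\theta(t)\big),$$ where all the signs $\pm$ agree with the sign in $\widetilde{\nu}=-\cos\theta\,\mu\pm\sin\theta\,\nu$. (2) Suppose that the set of $t\in I$ satisfying $\beta(t)\neq0$ and $\frac{d\lambda}{dt}(t)=\pm\beta(t)$ is dense in $I$, and that $f$ is the unique envelope created by $\mathcal{C}_{(\gamma,\lambda)}$, with Gauss mapping $\widetilde{\nu}:I\to S^1$ (its creator). Then the following four hold. (2-i) $\gamma$ is the evolute of $f$. (2-ii) For a fixed angle $\phi\notin\{\frac{\pi}{2}+k\pi\mid k\in\mathbb{Z}\}$, the circle family $\mathcal{C}_{(\gamma,\cos\phi\,\lambda)}$ creates two envelopes $f_1$ and $f_2$ such that $f_1(t)=\mathcal{E}v_f[\phi](t)$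 and $f_2(t)=\mathcal{E}v_f[\pi-\phi](t)$. (2-iii) Let $P\in\mathbb{R}^2$ be a fixed point with $P\notin\{\gamma(t)\mid t\in I\}$, and let $\gamma_1(t)=\frac{\gamma(t)+P}{2}$, $\lambda_1(t)=\left\|\frac{\gamma(t)-P}{2}\right\|$. Then the circle family $\mathcal{C}_{(\gamma_1,\lambda_1)}$ creates envelopes $f_1$ and $f_2$ such that $f_1(t)=P$ and $f_2(t)=\mathcal{CP}e_{f,P}(t)$. (2-iv) Let $\phi$ be a fixed angle and let $P\in\mathbb{R}^2$ be a fixed point with $P\notin\{\mathcal{E}v_f[\phi+\frac{\pi}{2}](t)\mid t\in I\}$. Let $$\gamma_2(t)=\frac{\gamma(t)+\lambda(t)\sin\phi\big(-\sin\phi\,\mu(t)+\cos\phi\,\nu(t)\big)+P}{2},$$ $$\lambda_2(t)=\frac{\big\|\gamma(t)+\lambda(t)\sin\phi\big(-\sin\phi\,\mu(t)+\cos\phi\,\nu(t)\big)-P\big\|}{2}.$$ Then the circle family $\mathcal{C}_{(\gamma_2,\lambda_2)}$ creates envelopes $f_1$ and $f_2$ such that $f_1(t)=P$ and $f_2(t)=\mathcal{P}e_{f,P}[\phi](t)$. (3) Suppose that the set of $t\in I$ satisfying $\beta(t)\neq0$ and $|\frac{d\lambda}{dt}(t)|\le|\beta(t)|$ is dense in $I$, and that the circle family $\mathcal{C}_{(\gamma,\lambda)}$ creates envelopes $f_1$ and $f_2$. Suppose moreover that $f_1$ is a constant vector. Then $$f_2(t)=\mathcal{P}e_{2\gamm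a(t)-f_1,\,f_1}(t).$$
   Context: **Frontals.** $J$ is the anti-clockwise rotation of $\mathbb{R}^2$ by $\pi/2$, the dot $\cdot$ between vectors is the standard scalar product, $\|\cdot\|$ is the Euclidean norm, and $\mathbb{R}_+$ is the set of positive reals. A $C^\infty$ mapping $\gamma:I\to\mathbb{R}^2$ on an open interval $I$ is a frontal if there is a $C^\infty$ mapping $\nu:I\to S^1$ (a Gauss mapping of $\gamma$) with $\frac{d\gamma}{dt}(t)\cdot\nu(t)=0$ for all $t$. Put $\mu(t)=J(\nu(t))$; $\{\nu,\mu\}$ is the moving frame. Put $l(t)=\dot\nu(t)\cdot\mu(t)$, and let $\beta$ be the $C^\infty$ function with $\dot\gamma(t)=\beta(t)\mu(t)$. Then $\dot\nu=l\mu$, $\dot\mu=-l\nu$. The pair $(l,\beta)$ is the curvature of the frontal $\gamma$ (with respect to $\nu$). **Circle families.** For $P\in\mathbb{R}^2$ and $\lambda>0$, $C_{(P,\lambda)}=\{x\in\mathbb{R}^2\mid (x-P)\cdot(x-P)=\lambda^2\}$; the same formula is used when the radius function is negative (as $\cos\phi\,\lambda$ may be). For a curve of centers $\gamma$ and a radius function $\lambda$ on $I$, $\mathcal{C}_{(\gamma,\lambda)}=\{C_{(\gamma(t),\lambda(t))}\}_{t\in I}$. **Envelopes.** A $C^\infty$ mapping $f:I\to\mathbb{R}^2$ is an envelope of (is created by) $\mathcal{C}_{(\gamma,\lambda)}$ if for all $t\in I$: $f(t)\in C_{(\gamma(t),\lambda(t))}$ and $\dot f(t)\cdot(f(t)-\gamma(t))=0$.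 **Creator.** It is known that every envelope has the form $f(t)=\gamma(t)+\lambda(t)\widetilde{\nu}(t)$ with a $C^\infty$ mapping $\widetilde{\nu}:I\to S^1$, called the creator of $f$, satisfying $\frac{d\lambda}{dt}(t)=-\beta(t)(\widetilde{\nu}(t)\cdot\mu(t))$. Setting $\cos\theta(t)=-\widetilde{\nu}(t)\cdot\mu(t)$ with $\theta:I\to\mathbb{R}$ of class $C^\infty$, one has $\frac{d\lambda}{dt}=\cos\theta\,\beta$ and $\widetilde{\nu}=-\cos\theta\,\mu\pm\sin\theta\,\nu$. **Pairs of envelopes.** When a family is said to create (two) envelopes $f_1$ and $f_2$, these are the envelopes given by the two choices of sign in $\gamma+\lambda(-\cos\theta\,\mu\pm\sin\theta\,\nu)$, in some order, for one and the same $C^\infty$ function $\theta$ with $\frac{d\lambda}{dt}=\cos\theta\,\beta$ (with frame and curvature of the family's own curve of centers, and with its own radius function); they coincide if $\sin\theta\equiv0$. **Evolute and evolutoid.** Let $g:I\to\mathbb{R}^2$ be a frontal with Gauss mapping $n$, $m=J(n)$ and curvature $(l_g,\beta_g)$, and suppose there is a $C^\infty$ function $\alpha:I\to\mathbb{R}$ with $\beta_g=l_g\alpha$. The evolute of $g$ is $\mathcal{E}v(g)(t)=g(t)-\alpha(t)n(t)$, and for a fixed angle $\phi$ the $\phi$-evolutoid of $g$ is $$\mathcal{E}v_g[\phi](t)=g(t)-\alpha(t)\sin\phi\,(\cos\phi\, m(t)+\sin\phi\, n(t)).$$ In part (2) these are applied to $g=f$ with Gauss mapping $\widetilde{\nu}$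 and $\alpha=\lambda$ (one has $\beta_f=\lambda l_f$ there). **Pedaloid, pedal, contrapedal.** For a frontal $g:I\to\mathbb{R}^2$ with Gauss mapping $n:I\to S^1$ and $m=J(n)$, a fixed point $P\in\mathbb{R}^2$ and a fixed angle $\phi$, the $\phi$-pedaloid of $g$ relative to $P$ is $$\mathcal{P}e_{g,P}[\phi](t)=g(t)+[(P-g(t))\cdot(\sin\phi\, m(t)-\cos\phi\, n(t))](\sin\phi\, m(t)-\cos\phi\, n(t)).$$ The pedal is $\mathcal{P}e_{g,P}=\mathcal{P}e_{g,P}[\frac{\pi}{2}]$ and the contrapedal is $\mathcal{CP}e_{g,P}=\mathcal{P}e_{g,P}[0]$. In part (3), $2\gamma-f_1$ is regarded as a frontal with the Gauss mapping $\nu$ of $\gamma$.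
   Formalization: In (2-iv), the printed γ₂ and λ₂ are wrong when dλ/dt = −β; the proved version multiplies the term λ sin φ(−sin φ μ + cos φ ν) by the constant sign σ with dλ/dt = σβ on I (existence of σ is proved), agreeing with the printed formula when σ = 1. *)

theory Defs
  imports "HOL-Analysis.Analysis"
begin

text \<open>All functions below are total on the reals; only their values on the open interval I matter,
  and for open I derivatives at points of I depend only on the values on I.\<close>

definition smooth_on :: "real set \<Rightarrow> (real \<Rightarrow> 'a::real_normed_vector) \<Rightarrow> bool" where
  "smooth_on I f \<longleftrightarrow>
     (\<forall>k. \<forall>t\<in>I. ((\<lambda>g x. vector_derivative g (at x)) ^^ k) f differentiable (at t))"

definition J :: "real^2 \<Rightarrow> real^2" where
  "J v = vector [- (v $ 2), v $ 1]"

definition frontal :: "real set \<Rightarrow> (real \<Rightarrow> real^2) \<Rightarrow> (real \<Rightarrow> real^2) \<Rightarrow> bool" where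
  "frontal I g n \<longleftrightarrow> smooth_on I g \<and> smooth_on I n \<and>
     (\<forall>t\<in>I. norm (n t) = 1 \<and> vector_derivative g (at t) \<bullet> n t = 0)"

text \<open>The frontal g with Gauss mapping n has curvature (l, b).\<close>

definition frontal_curvature ::
    "real set \<Rightarrow> (real \<Rightarrow> real^2) \<Rightarrow> (real \<Rightarrow> real^2) \<Rightarrow> (real \<Rightarrow> real) \<Rightarrow> (real \<Rightarrow> real) \<Rightarrow> bool" where
  "frontal_curvature I g n l b \<longleftrightarrow> frontal I g n \<and> smooth_on I b \<and>
     (\<forall>t\<in>I. l t = vector_derivative n (at t) \<bullet> J (n t) \<and>
            vector_derivative g (at t) = b t *\<^sub>R J (n t))"

text \<open>The radius r is allowed to be negative.\<close>

definition circle :: "real^2 \<Rightarrow> real \<Rightarrow> (real^2) set" where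
  "circle P r = {x. (x - P) \<bullet> (x - P) = r\<^sup>2}"

text \<open>The circle family with centers c and radii r creates the envelope f.\<close>

definition envelope ::
    "real set \<Rightarrow> (real \<Rightarrow> real^2) \<Rightarrow> (real \<Rightarrow> real) \<Rightarrow> (real \<Rightarrow> real^2) \<Rightarrow> bool" where
  "envelope I c r f \<longleftrightarrow> smooth_on I f \<and>
     (\<forall>t\<in>I. f t \<in> circle (c t) (r t) \<and> vector_derivative f (at t) \<bullet> (f t - c t) = 0)"

text \<open>Here c is a frontal with Gauss mapping n and second curvature component b, and f is an
  envelope of the family with centers c and radii r; m is the creator of f.\<close>

definition creator ::
    "real set \<Rightarrow> (real \<Rightarrow> real^2) \<Rightarrow> (real \<Rightarrow> real^2) \<Rightarrow> (real \<Rightarrow> real) \<Rightarrow> (real \<Rightarrow> real) \<Rightarrow>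
      (real \<Rightarrow> real^2) \<Rightarrow> (real \<Rightarrow> real^2) \<Rightarrow> bool" where
  "creator I c n b r f m \<longleftrightarrow> smooth_on I m \<and>
     (\<forall>t\<in>I. norm (m t) = 1 \<and> f t = c t + r t *\<^sub>R m t \<and>
            (r has_real_derivative - b t * (m t \<bullet> J (n t))) (at t))"

text \<open>The family with centers c (a frontal with Gauss mapping n) and radii r creates the two
  envelopes f1 and f2: they come from one function \<theta> and opposite signs, in either order.\<close>

definition envelope_pair ::
    "real set \<Rightarrow> (real \<Rightarrow> real^2) \<Rightarrow> (real \<Rightarrow> real^2) \<Rightarrow> (real \<Rightarrow> real) \<Rightarrow>
      (real \<Rightarrow> real^2) \<Rightarrow> (real \<Rightarrow> real^2) \<Rightarrow> bool" where
  "envelope_pair I c n r f1 f2 \<longleftrightarrow> envelope I c r f1 \<and> envelope I c r f2 \<and>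
     (\<exists>l b \<theta>. \<exists>s\<in>{1, -1}. frontal_curvature I c n l b \<and> smooth_on I \<theta> \<and>
        (\<forall>t\<in>I. (r has_real_derivative cos (\<theta> t) * b t) (at t) \<and>
           f1 t = c t + r t *\<^sub>R (- cos (\<theta> t) *\<^sub>R J (n t) + (s * sin (\<theta> t)) *\<^sub>R n t) \<and>
           f2 t = c t + r t *\<^sub>R (- cos (\<theta> t) *\<^sub>R J (n t) - (s * sin (\<theta> t)) *\<^sub>R n t)))"

text \<open>The condition under which evolute and evolutoids of the frontal g with Gauss mapping n
  are defined, by means of the function \<alpha>.\<close>

definition evolute_function ::
    "real set \<Rightarrow> (real \<Rightarrow> real^2) \<Rightarrow> (real \<Rightarrow> real^2) \<Rightarrow> (real \<Rightarrow> real) \<Rightarrow> bool" where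
  "evolute_function I g n \<alpha> \<longleftrightarrow> smooth_on I \<alpha> \<and>
     (\<exists>l b. frontal_curvature I g n l b \<and> (\<forall>t\<in>I. b t = l t * \<alpha> t))"

definition evolute ::
    "(real \<Rightarrow> real^2) \<Rightarrow> (real \<Rightarrow> real^2) \<Rightarrow> (real \<Rightarrow> real) \<Rightarrow> real \<Rightarrow> real^2" where
  "evolute g n \<alpha> t = g t - \<alpha> t *\<^sub>R n t"

definition evolutoid ::
    "(real \<Rightarrow> real^2) \<Rightarrow> (real \<Rightarrow> real^2) \<Rightarrow> (real \<Rightarrow> real) \<Rightarrow> real \<Rightarrow> real \<Rightarrow> real^2" where
  "evolutoid g n \<alpha> \<phi> t = g t - (\<alpha> t * sin \<phi>) *\<^sub>R (cos \<phi> *\<^sub>R J (n t) + sin \<phi> *\<^sub>R n t)"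

definition pedaloid ::
    "(real \<Rightarrow> real^2) \<Rightarrow> (real \<Rightarrow> real^2) \<Rightarrow> real^2 \<Rightarrow> real \<Rightarrow> real \<Rightarrow> real^2" where
  "pedaloid g n P \<phi> t = g t +
     ((P - g t) \<bullet> (sin \<phi> *\<^sub>R J (n t) - cos \<phi> *\<^sub>R n t)) *\<^sub>R (sin \<phi> *\<^sub>R J (n t) - cos \<phi> *\<^sub>R n t)"

definition pedal ::
    "(real \<Rightarrow> real^2) \<Rightarrow> (real \<Rightarrow> real^2) \<Rightarrow> real^2 \<Rightarrow> real \<Rightarrow> real^2" where
  "pedal g n P = pedaloid g n P (pi / 2)"

definition contrapedal ::
    "(real \<Rightarrow> real^2) \<Rightarrow> (real \<Rightarrow> real^2) \<Rightarrow> real^2 \<Rightarrow> real \<Rightarrow> real^2" where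
  "contrapedal g n P = pedaloid g n P 0"

text \<open>The curve whose midpoints with a point P are the centers of the circles that create the
  pedaloids. The sign s is that of r' = s b, where b is the second curvature component of c. For
  s = 1 this is c + r sin \<phi> (- sin \<phi> J n + cos \<phi> n). For s = -1 the minus sign is needed:
  with c = (t, 0), n = (0, 1) and r = t (t > 0) one has b = -1, and the family with centers c and
  radii r has the unique envelope 0. With a plus sign, \<phi> = pi / 2 and P = (1, 1) would give the
  circles with diameter from (1, 1) to (2 t, 0), which do not pass through the pedal point (0, 1).
  With the sign as below, the curve is the evolutoid of angle \<phi> + pi / 2 of the envelope of the
  family (with its creator as Gauss mapping and \<alpha> = r), for both values of s.\<close>

definition pedaloid_base ::
    "real \<Rightarrow> (real \<Rightarrow> real^2) \<Rightarrow> (real \<Rightarrow> real^2) \<Rightarrow> (real \<Rightarrow> real) \<Rightarrow> real \<Rightarrow> real \<Rightarrow> real^2" where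
  "pedaloid_base s c n r \<phi> t =
     c t + (s * r t * sin \<phi>) *\<^sub>R (- sin \<phi> *\<^sub>R J (n t) + cos \<phi> *\<^sub>R n t)"

end

theory Submission
  imports Defs
begin

text \<open>Everything is a computation in a moving frame. If \<open>c\<close> is a frontal with Gauss mapping \<open>n\<close> and curvature
\<open>(l, b)\<close>, then \<open>n' = l J n\<close>, \<open>(J n)' = - l n\<close> and \<open>c' = b J n\<close>. Let \<open>f = c + r m\<close> with
\<open>m = - cos \<theta> J n + s sin \<theta> n\<close> and \<open>r' = b cos \<theta>\<close>. Differentiating, \<open>m\<close> is again a rotating frame vector,
with \<open>m' = (l + s \<theta>') J m\<close>, and the component of \<open>c'\<close> along \<open>m\<close> cancels against \<open>r' m\<close>, so that \<open>f'\<close>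
is a multiple of \<open>J m\<close>. This is lemma \<open>envelope_frontal_curvature\<close>. It computes the curvature of an
envelope, and since \<open>f - c\<close> is a multiple of \<open>m\<close> it also shows that every curve of this form is an
envelope. Hence, to exhibit a pair of envelopes it suffices to find the angle \<open>\<theta>\<close> and to compare
formulas (\<open>envelope_pairI\<close>).

When \<open>r' = \<plusminus> b\<close> with \<open>b \<noteq> 0\<close> on a dense set, the creator satisfies \<open>m \<bullet> J n = \<plusminus> 1\<close> on that set, hence
everywhere, and on the interval the sign is constant by connectedness (\<open>creator_is_tangent\<close>). So the
creator is \<open>- \<sigma> J n\<close> for one sign \<open>\<sigma>\<close>, which is the case of a constant angle (0 or \<open>\<pi>\<close>). The envelope is
then \<open>f = c - \<sigma> r J n\<close>, its curvature is \<open>(l, r l)\<close>, and \<open>c\<close> is its evolute. Its evolutoid of angle \<open>\<phi>\<close>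
belongs to the constant angle \<open>\<phi>\<close> or \<open>\<phi> + \<pi>\<close> for the radius \<open>r cos \<phi>\<close>.

The pedal-type statements come from Thales' theorem (\<open>thales_envelope_pair\<close>). For any frontal \<open>c\<close> and
any point \<open>P\<close> off it, the circles with diameter from \<open>P\<close> to \<open>c t\<close> envelop the constant curve \<open>P\<close> and the
foot of the perpendicular from \<open>c t\<close> to the normal line through \<open>P\<close>. The angle is here the polar angle
of \<open>c - P\<close> in the moving frame, and a smooth choice of it exists on an interval (\<open>smooth_angle\<close>). For
the pedaloid of angle \<open>\<phi>\<close>, \<open>c\<close> is replaced by the evolutoid of angle \<open>\<phi> + \<pi> / 2\<close> of the envelope, a
frontal whose Gauss mapping is \<open>n\<close> turned by \<open>- \<phi>\<close>; that foot is then the pedaloid of the envelope. The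
contrapedal is the case \<open>\<phi> = 0\<close>, in which the evolutoid is the evolute.

If conversely one envelope of a pair is a constant \<open>P\<close>, then \<open>2 c - P\<close> is the point of the circle
antipodal to \<open>P\<close>, and the other envelope, being the mirror image of \<open>P\<close> in the line through \<open>c\<close> with
direction \<open>J n\<close>, is the foot of the perpendicular from \<open>P\<close> to the tangent line of \<open>2 c - P\<close>.\<close>

section \<open>Smooth functions of one variable\<close>

text \<open>Only the existence of the derivatives on the set is asked for, not a choice of them off the set. The
condition is therefore recursive in the derivative, and closure properties follow by induction over the
order.\<close>

primrec times_differentiable :: "nat \<Rightarrow> real set \<Rightarrow> (real \<Rightarrow> 'a::real_normed_vector) \<Rightarrow> bool" where
  "times_differentiable 0 I f \<longleftrightarrow> True"
| "times_differentiable (Suc k) I f \<longleftrightarrow>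
     (\<exists>f'. (\<forall>t\<in>I. (f has_vector_derivative f' t) (at t)) \<and> times_differentiable k I f')"

lemma times_differentiable_SucD: "times_differentiable (Suc k) I f \<Longrightarrow> times_differentiable k I f"
proof (induction k arbitrary: f)
  case (Suc k)
  then show ?case by (metis times_differentiable.simps(2))
qed simp

lemma times_differentiable_cong:
  assumes "open I" "times_differentiable k I f" "\<And>t. t \<in> I \<Longrightarrow> f t = g t"
  shows "times_differentiable k I g"
proof (cases k)
  case (Suc j)
  with assms obtain f' where f': "\<forall>t\<in>I. (f has_vector_derivative f' t) (at t)"
    "times_differentiable j I f'" by auto
  have "(g has_vector_derivative f' t) (at t)" if "t \<in> I" for t
    using has_vector_derivative_transform_within_open[OF _ \<open>open I\<close> that] f'(1) that assms(3) by blast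
  with f'(2) Suc show ?thesis by auto
qed simp

text \<open>The iterated derivatives are functions on the whole line, while the recursive notion sees them only on
\<open>I\<close>. As \<open>I\<close> is open, derivatives at its points depend on values in \<open>I\<close> alone, so both notions agree.\<close>

lemma smooth_on_iff:
  assumes "open I"
  shows "smooth_on I f \<longleftrightarrow> (\<forall>k. times_differentiable k I f)"
proof
  assume f: "smooth_on I f"
  have "times_differentiable k I (((\<lambda>g x. vector_derivative g (at x)) ^^ j) f)" for k j
  proof (induction k arbitrary: j)
    case (Suc k)
    have "(((\<lambda>g x. vector_derivative g (at x)) ^^ j) f has_vector_derivative
        ((\<lambda>g x. vector_derivative g (at x)) ^^ Suc j) f t) (at t)" if "t \<in> I" for t
      using f that unfolding smooth_on_def by (simp add: vector_derivative_works)
    with Suc[of "Suc j"] show ?case unfolding times_differentiable.simps by blast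
  qed simp
  from this[of _ 0] show "\<forall>k. times_differentiable k I f" by simp
next
  have deriv: "times_differentiable k I (\<lambda>x. vector_derivative g (at x))"
    if g: "times_differentiable (Suc k) I g" for g :: "real \<Rightarrow> 'a" and k
  proof -
    from g obtain g' where "\<forall>t\<in>I. (g has_vector_derivative g' t) (at t)"
      "times_differentiable k I g'" by auto
    then show ?thesis
      using times_differentiable_cong[OF assms, of k g'] by (metis vector_derivative_at)
  qed
  assume f: "\<forall>k. times_differentiable k I f"
  have *: "\<forall>k. times_differentiable k I (((\<lambda>g x. vector_derivative g (at x)) ^^ j) f)" for j
  proof (induction j)
    case (Suc j)
    then show ?case using deriv by (simp del: times_differentiable.simps)
  qed (simp add: f)
  show "smooth_on I f"
    unfolding smooth_on_def
  proof (intro allI ballI)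
    fix j t assume "t \<in> I"
    with *[of j, rule_format, of 1]
    show "((\<lambda>g x. vector_derivative g (at x)) ^^ j) f differentiable at t"
      by (auto intro: differentiableI_vector)
  qed
qed

lemma smooth_on_cong:
  assumes "open I" "smooth_on I f" "\<And>t. t \<in> I \<Longrightarrow> f t = g t"
  shows "smooth_on I g"
  using times_differentiable_cong[OF assms(1) _ assms(3)] assms(2)
  by (simp add: smooth_on_iff[OF assms(1)])

lemma smooth_on_has_vector_derivative:
  "smooth_on I f \<Longrightarrow> t \<in> I \<Longrightarrow> (f has_vector_derivative vector_derivative f (at t)) (at t)"
  unfolding smooth_on_def by (drule spec[of _ 0]) (simp add: vector_derivative_works)

lemma smooth_on_vector_derivative:
  assumes "smooth_on I f"
  shows "smooth_on I (\<lambda>t. vector_derivative f (at t))"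
  unfolding smooth_on_def
proof
  fix k
  show "\<forall>t\<in>I. ((\<lambda>g x. vector_derivative g (at x)) ^^ k) (\<lambda>t. vector_derivative f (at t))
      differentiable at t"
    using assms[unfolded smooth_on_def, rule_format, of _ "Suc k"] by (simp only: funpow_Suc_right comp_apply) blast
qed

lemma smooth_on_antiderivative:
  assumes "open I" "smooth_on I f'" "\<And>t. t \<in> I \<Longrightarrow> (f has_vector_derivative f' t) (at t)"
  shows "smooth_on I f"
  unfolding smooth_on_iff[OF assms(1)]
proof
  fix k
  have "times_differentiable (Suc k) I f"
    using assms smooth_on_iff[OF assms(1), of f'] by auto
  then show "times_differentiable k I f" by (rule times_differentiable_SucD)
qed

lemma times_differentiable_const: "times_differentiable k I (\<lambda>t. c)"
proof (induction k arbitrary: c)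
  case (Suc k)
  from Suc[of 0] show ?case by (auto intro!: exI[of _ "\<lambda>t. 0"])
qed simp

lemma smooth_on_const: "open I \<Longrightarrow> smooth_on I (\<lambda>t. c)"
  by (simp add: smooth_on_iff times_differentiable_const)

lemma times_differentiable_add:
  "times_differentiable k I f \<Longrightarrow> times_differentiable k I g \<Longrightarrow>
    times_differentiable k I (\<lambda>t. f t + g t)"
proof (induction k arbitrary: f g)
  case (Suc k)
  then obtain f' g' where "\<forall>t\<in>I. (f has_vector_derivative f' t) (at t)" "times_differentiable k I f'"
    "\<forall>t\<in>I. (g has_vector_derivative g' t) (at t)" "times_differentiable k I g'" by auto
  then show ?case using Suc.IH[of f' g']
    by (auto intro!: exI[of _ "\<lambda>t. f' t + g' t"] has_vector_derivative_add)
qed simp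

lemma smooth_on_add:
  "open I \<Longrightarrow> smooth_on I f \<Longrightarrow> smooth_on I g \<Longrightarrow> smooth_on I (\<lambda>t. f t + g t)"
  by (simp add: smooth_on_iff times_differentiable_add)

lemma times_differentiable_linear:
  assumes "bounded_linear L"
  shows "times_differentiable k I f \<Longrightarrow> times_differentiable k I (\<lambda>t. L (f t))"
proof (induction k arbitrary: f)
  case (Suc k)
  then obtain f' where "\<forall>t\<in>I. (f has_vector_derivative f' t) (at t)" "times_differentiable k I f'"
    by auto
  then show ?case using Suc.IH[of f']
    by (auto intro!: exI[of _ "\<lambda>t. L (f' t)"] bounded_linear.has_vector_derivative[OF assms])
qed simp

lemma smooth_on_linear:
  "bounded_linear L \<Longrightarrow> open I \<Longrightarrow> smooth_on I f \<Longrightarrow> smooth_on I (\<lambda>t. L (f t))"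
  by (simp add: smooth_on_iff times_differentiable_linear)

lemmas smooth_on_minus = smooth_on_linear[OF bounded_linear_minus[OF bounded_linear_ident]]

text \<open>One product rule serves scalar multiples, products of real functions and inner products.\<close>

lemma times_differentiable_bilinear:
  assumes "bounded_bilinear B"
  shows "times_differentiable k I f \<Longrightarrow> times_differentiable k I g \<Longrightarrow>
    times_differentiable k I (\<lambda>t. B (f t) (g t))"
proof (induction k arbitrary: f g)
  case (Suc k)
  then obtain f' g' where *: "\<forall>t\<in>I. (f has_vector_derivative f' t) (at t)" "times_differentiable k I f'"
    "\<forall>t\<in>I. (g has_vector_derivative g' t) (at t)" "times_differentiable k I g'" by auto
  moreover have "times_differentiable k I (\<lambda>t. B (f t) (g' t) + B (f' t) (g t))"
    using * Suc.prems[THEN times_differentiable_SucD] by (intro times_differentiable_add Suc.IH)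
  ultimately show ?case
    by (auto intro!: exI[of _ "\<lambda>t. B (f t) (g' t) + B (f' t) (g t)"]
        bounded_bilinear.has_vector_derivative[OF assms])
qed simp

lemma smooth_on_bilinear:
  "bounded_bilinear B \<Longrightarrow> open I \<Longrightarrow> smooth_on I f \<Longrightarrow> smooth_on I g \<Longrightarrow>
    smooth_on I (\<lambda>t. B (f t) (g t))"
  by (simp add: smooth_on_iff times_differentiable_bilinear)

lemmas smooth_on_scaleR = smooth_on_bilinear[OF bounded_bilinear_scaleR]
lemmas smooth_on_inner = smooth_on_bilinear[OF bounded_bilinear_inner]
lemmas smooth_on_mult =
  smooth_on_bilinear[OF bounded_bilinear_mult[where ?'a = real]]

lemma smooth_on_diff:
  "open I \<Longrightarrow> smooth_on I f \<Longrightarrow> smooth_on I g \<Longrightarrow> smooth_on I (\<lambda>t. f t - g t)"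
  using smooth_on_add[of I f "\<lambda>t. - g t"] smooth_on_minus[of I g] by simp

lemma times_differentiable_compose:
  fixes f :: "real \<Rightarrow> real"
  shows "f ` I \<subseteq> U \<Longrightarrow> times_differentiable k U h \<Longrightarrow> times_differentiable k I f \<Longrightarrow>
    times_differentiable k I (\<lambda>t. h (f t))"
proof (induction k arbitrary: h)
  case (Suc k)
  then obtain h' f' where *: "\<forall>t\<in>U. (h has_vector_derivative h' t) (at t)" "times_differentiable k U h'"
    "\<forall>t\<in>I. (f has_vector_derivative f' t) (at t)" "times_differentiable k I f'" by auto
  have "((\<lambda>t. h (f t)) has_vector_derivative f' t *\<^sub>R h' (f t)) (at t)" if "t \<in> I" for t
    using vector_diff_chain_at[of f "f' t" t h "h' (f t)"] * that Suc.prems(1) by (auto simp: o_def)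
  moreover have "times_differentiable k I (\<lambda>t. f' t *\<^sub>R h' (f t))"
    using * Suc.prems(1) times_differentiable_SucD[OF Suc.prems(3)]
    by (intro times_differentiable_bilinear[OF bounded_bilinear_scaleR] Suc.IH)
  ultimately show ?case
    by (auto intro!: exI[of _ "\<lambda>t. f' t *\<^sub>R h' (f t)"])
qed simp

lemma smooth_on_compose:
  fixes f :: "real \<Rightarrow> real"
  shows "open U \<Longrightarrow> smooth_on U h \<Longrightarrow> f ` I \<subseteq> U \<Longrightarrow> open I \<Longrightarrow> smooth_on I f \<Longrightarrow>
    smooth_on I (\<lambda>t. h (f t))"
  by (simp add: smooth_on_iff times_differentiable_compose[where U = U])

text \<open>Linear combinations of sine and cosine are closed under differentiation, so the induction runs over
all of them at once; real powers are treated likewise below, with all exponents at once.\<close>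

lemma smooth_on_sin_cos_UNIV: "smooth_on UNIV (sin :: real \<Rightarrow> real)" "smooth_on UNIV (cos :: real \<Rightarrow> real)"
proof -
  have "times_differentiable k UNIV (\<lambda>t::real. a * sin t + b * cos t)" for k a b
  proof (induction k arbitrary: a b)
    case (Suc k)
    have "((\<lambda>t::real. a * sin t + b * cos t) has_vector_derivative (-b) * sin t + a * cos t) (at t)" for t
      unfolding has_real_derivative_iff_has_vector_derivative[symmetric]
      by (auto intro!: derivative_eq_intros)
    with Suc[of "-b" a] show ?case
      by (auto intro!: exI[of _ "\<lambda>t. (-b) * sin t + a * cos t"])
  qed simp
  from this[of _ 1 0] this[of _ 0 1] show "smooth_on UNIV (sin :: real \<Rightarrow> real)"
    "smooth_on UNIV (cos :: real \<Rightarrow> real)" by (simp_all add: smooth_on_iff)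
qed

lemma smooth_on_powr_pos: "smooth_on {0<..} (\<lambda>x::real. x powr a)"
proof -
  have "times_differentiable k {0<..} (\<lambda>x::real. c * x powr a)" for k c a
  proof (induction k arbitrary: c a)
    case (Suc k)
    have "((\<lambda>x::real. c * x powr a) has_vector_derivative (c * a) * x powr (a - 1)) (at x)"
      if "x \<in> {0<..}" for x
      unfolding has_real_derivative_iff_has_vector_derivative[symmetric]
      using that by (auto intro!: derivative_eq_intros)
    with Suc[of "c * a" "a - 1"] show ?case
      by (auto intro!: exI[of _ "\<lambda>x. (c * a) * x powr (a - 1)"])
  qed simp
  from this[of _ 1] show ?thesis by (simp add: smooth_on_iff)
qed

lemmas smooth_on_sin = smooth_on_compose[OF open_UNIV smooth_on_sin_cos_UNIV(1) subset_UNIV]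
lemmas smooth_on_cos = smooth_on_compose[OF open_UNIV smooth_on_sin_cos_UNIV(2) subset_UNIV]

text \<open>Away from its zeros, the norm is the power \<open>a = 1\<close> and its reciprocal the power \<open>a = -1\<close>. Writing
\<open>norm v powr a\<close> as \<open>(v \<bullet> v) powr (a / 2)\<close> leaves only smooth ingredients.\<close>

lemma smooth_on_norm_powr:
  fixes f :: "real \<Rightarrow> 'a::real_inner"
  assumes "open I" "smooth_on I f" "\<And>t. t \<in> I \<Longrightarrow> f t \<noteq> 0"
  shows "smooth_on I (\<lambda>t. norm (f t) powr a)"
proof -
  have "smooth_on I (\<lambda>t. (f t \<bullet> f t) powr (a / 2))"
    using assms by (intro smooth_on_compose[OF _ smooth_on_powr_pos] smooth_on_inner) auto
  moreover have "(f t \<bullet> f t) powr (a / 2) = norm (f t) powr a" for t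
    unfolding dot_square_norm by (simp add: powr_powr flip: powr_numeral)
  ultimately show ?thesis by simp
qed

lemma smooth_on_norm:
  fixes f :: "real \<Rightarrow> 'a::real_inner"
  assumes "open I" "smooth_on I f" "\<And>t. t \<in> I \<Longrightarrow> f t \<noteq> 0"
  shows "smooth_on I (\<lambda>t. norm (f t))"
  using smooth_on_norm_powr[OF assms, of 1] by simp

lemma smooth_on_inverse_norm:
  fixes f :: "real \<Rightarrow> 'a::real_inner"
  assumes "open I" "smooth_on I f" "\<And>t. t \<in> I \<Longrightarrow> f t \<noteq> 0"
  shows "smooth_on I (\<lambda>t. inverse (norm (f t)))"
  using smooth_on_norm_powr[OF assms, of "-1"] by (simp add: powr_minus)

lemma bounded_linear_J: "bounded_linear J"
  by (rule linear_conv_bounded_linear[THEN iffD1], rule linearI)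
    (simp_all add: J_def vec_eq_iff forall_2)

lemmas smooth_on_J = smooth_on_linear[OF bounded_linear_J]
lemmas has_vector_derivative_J = bounded_linear.has_vector_derivative[OF bounded_linear_J]

lemmas smooth_on_intros = smooth_on_const smooth_on_add smooth_on_diff smooth_on_minus
  smooth_on_scaleR smooth_on_mult smooth_on_inner smooth_on_sin smooth_on_cos smooth_on_J

section \<open>A smooth choice of angle\<close>

lemma open_interval_antiderivative:
  fixes f :: "real \<Rightarrow> real"
  assumes I: "open I" "is_interval I" and f: "\<And>t. t \<in> I \<Longrightarrow> isCont f t"
  obtains F where "\<And>t. t \<in> I \<Longrightarrow> (F has_real_derivative f t) (at t)"
proof (cases "I = {}")
  case False
  define a b where "a = Inf (ereal ` I)" and "b = Sup (ereal ` I)"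
  have sub: "a < ereal t \<and> ereal t < b" if t: "t \<in> I" for t
  proof -
    obtain e where "e > 0" "cball t e \<subseteq> I" 
      using bspec[OF open_contains_cball[THEN iffD1, OF I(1)] t] by blast
    then have "t - e \<in> I" "t + e \<in> I" using \<open>e > 0\<close> by (simp_all add: subsetD dist_real_def)
    then have "a \<le> ereal (t - e)" "ereal (t + e) \<le> b"
      unfolding a_def b_def by (simp_all add: Inf_lower Sup_upper)
    moreover have "ereal (t - e) < ereal t" "ereal t < ereal (t + e)" using \<open>e > 0\<close> by auto
    ultimately show ?thesis using le_less_trans less_le_trans by metis
  qed
  have sup: "t \<in> I" if "a < ereal t" "ereal t < b" for t
  proof -
    from that(1) obtain y where "y \<in> I" "y < t" unfolding a_def Inf_less_iff by auto
    moreover from that(2) obtain z where "z \<in> I" "t < z" unfolding b_def less_Sup_iff by auto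
    ultimately show ?thesis using mem_is_interval_1_I[OF I(2), of y z t] by simp
  qed
  obtain t where "t \<in> I" using False by blast
  with sub[of t] have "a < b" by (meson less_trans)
  moreover have "isCont f x" if "a < ereal x" "ereal x < b" for x
    using f sup that by simp
  ultimately have "\<exists>F. \<forall>x. a < ereal x \<longrightarrow> ereal x < b \<longrightarrow> (F has_vector_derivative f x) (at x)"
    by (rule einterval_antiderivative)
  then obtain F where F: "\<And>x. a < ereal x \<Longrightarrow> ereal x < b \<Longrightarrow> (F has_vector_derivative f x) (at x)"
    by auto
  show ?thesis
  proof (rule that)
    fix t assume "t \<in> I"
    with sub F show "(F has_real_derivative f t) (at t)"
      by (simp add: has_real_derivative_iff_has_vector_derivative)
  qed
next
  case True
  then show ?thesis using that[of f] by simp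
qed

text \<open>A unit vector \<open>(p, q)\<close> with polar angle \<open>\<theta>\<close> has \<open>\<theta>' = p q' - q p'\<close>. So take \<open>\<theta>\<close> to be an antiderivative of
the right-hand side with the correct value at one point. The inner product of \<open>(p, q)\<close> with
\<open>(cos \<theta>, sin \<theta>)\<close> then has derivative 0 and equals 1 at that point; two unit vectors with inner product 1
are equal.\<close>

lemma smooth_angle:
  fixes p q :: "real \<Rightarrow> real"
  assumes I: "open I" "is_interval I" and p: "smooth_on I p" and q: "smooth_on I q"
    and unit: "\<And>t. t \<in> I \<Longrightarrow> (p t)\<^sup>2 + (q t)\<^sup>2 = 1"
  obtains \<theta> where "smooth_on I \<theta>" "\<And>t. t \<in> I \<Longrightarrow> cos (\<theta> t) = p t" "\<And>t. t \<in> I \<Longrightarrow> sin (\<theta> t) = q t"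
proof (cases "I = {}")
  case True
  then show ?thesis using that[of "\<lambda>_. 0"] I by (simp add: smooth_on_const)
next
  case False
  then obtain t0 where t0: "t0 \<in> I" by blast
  define p' q' where "p' = (\<lambda>t. vector_derivative p (at t))" and "q' = (\<lambda>t. vector_derivative q (at t))"
  define \<omega> where "\<omega> = (\<lambda>t. p t * q' t - q t * p' t)"
  have dp: "(p has_real_derivative p' t) (at t)" and dq: "(q has_real_derivative q' t) (at t)"
    if "t \<in> I" for t
    unfolding has_real_derivative_iff_has_vector_derivative p'_def q'_def
    using smooth_on_has_vector_derivative that p q by auto
  have \<omega>: "smooth_on I \<omega>"
    unfolding \<omega>_def p'_def q'_def using I p q by (intro smooth_on_intros smooth_on_vector_derivative)
  have "isCont \<omega> t" if "t \<in> I" for t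
    using smooth_on_has_vector_derivative[OF \<omega> that] has_vector_derivative_continuous by blast
  then obtain F where F: "\<And>t. t \<in> I \<Longrightarrow> (F has_real_derivative \<omega> t) (at t)"
    using open_interval_antiderivative[OF I] by blast
  obtain \<theta>0 where \<theta>0: "p t0 = cos \<theta>0" "q t0 = sin \<theta>0"
    using sincos_total_2pi[OF unit[OF t0]] by metis
  define \<theta> where "\<theta> t = F t + (\<theta>0 - F t0)" for t
  have d\<theta>: "(\<theta> has_real_derivative \<omega> t) (at t)" if "t \<in> I" for t
    unfolding \<theta>_def[abs_def] using F[OF that] by (auto intro!: derivative_eq_intros)
  have smooth: "smooth_on I \<theta>"
    using smooth_on_antiderivative[OF I(1) \<omega>] d\<theta>
    by (simp add: has_real_derivative_iff_has_vector_derivative)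
  define A where "A t = p t * cos (\<theta> t) + q t * sin (\<theta> t)" for t
  have dA: "(A has_real_derivative 0) (at t within I)" if t: "t \<in> I" for t
  proof -
    have "((\<lambda>t. (p t)\<^sup>2 + (q t)\<^sup>2) has_real_derivative 2 * p t * p' t + 2 * q t * q' t) (at t)"
      by (auto intro!: derivative_eq_intros dp dq t)
    moreover have "((\<lambda>t. (p t)\<^sup>2 + (q t)\<^sup>2) has_real_derivative 0) (at t)"
      by (rule has_field_derivative_transform_within_open[of "\<lambda>t. 1" _ _ I]) (auto simp: I t unit)
    ultimately have pq: "p t * p' t + q t * q' t = 0" using DERIV_unique by fastforce
    \<comment> \<open>The derivative of a unit vector is orthogonal to it, hence a multiple of its quarter turn.\<close>
    have p': "p' t = - q t * \<omega> t"
    proof -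
      have "p' t = ((p t)\<^sup>2 + (q t)\<^sup>2) * p' t" using unit[OF t] by simp
      also have "\<dots> = p t * (p t * p' t + q t * q' t) - q t * \<omega> t"
        unfolding \<omega>_def by (simp add: algebra_simps power2_eq_square)
      finally show ?thesis using pq by simp
    qed
    have q': "q' t = p t * \<omega> t"
    proof -
      have "q' t = ((p t)\<^sup>2 + (q t)\<^sup>2) * q' t" using unit[OF t] by simp
      also have "\<dots> = q t * (p t * p' t + q t * q' t) + p t * \<omega> t"
        unfolding \<omega>_def by (simp add: algebra_simps power2_eq_square)
      finally show ?thesis using pq by simp
    qed
    have "((\<lambda>t. cos (\<theta> t)) has_real_derivative - sin (\<theta> t) * \<omega> t) (at t)"
      "((\<lambda>t. sin (\<theta> t)) has_real_derivative cos (\<theta> t) * \<omega> t) (at t)"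
      by (rule DERIV_chain2[OF DERIV_cos d\<theta>[OF t]] DERIV_chain2[OF DERIV_sin d\<theta>[OF t]])+
    from DERIV_add[OF DERIV_mult[OF dp[OF t] this(1)] DERIV_mult[OF dq[OF t] this(2)]]
    have "(A has_real_derivative 0) (at t)"
      unfolding A_def[abs_def] by (simp add: p' q' algebra_simps)
    then show ?thesis by (rule has_field_derivative_at_within)
  qed
  obtain c where c: "\<forall>t\<in>I. A t = c"
    using has_field_derivative_zero_constant[OF _ dA] I is_interval_convex by blast
  have "A t0 = 1"
    by (simp add: A_def \<theta>_def \<theta>0 flip: power2_eq_square)
  then have A: "A t = 1" if "t \<in> I" for t using c t0 that by simp
  have "(cos (\<theta> t) - p t)\<^sup>2 + (sin (\<theta> t) - q t)\<^sup>2 = 0" if "t \<in> I" for t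
    using A[OF that] unit[OF that] sin_cos_squared_add[of "\<theta> t"]
    unfolding A_def power2_diff by (simp add: algebra_simps)
  then have "cos (\<theta> t) = p t \<and> sin (\<theta> t) = q t" if "t \<in> I" for t
    using that by (simp add: sum_power2_eq_zero_iff)
  then show ?thesis using that[OF smooth] by blast
qed

section \<open>Moving frames\<close>

lemma J_linear_simps:
  "J (v + w) = J v + J w" "J (v - w) = J v - J w" "J (- v) = - J v" "J (a *\<^sub>R v) = a *\<^sub>R J v"
  by (simp_all add: J_def vec_eq_iff forall_2)

lemma J_J: "J (J v) = - v"
  by (simp add: J_def vec_eq_iff forall_2)

lemma inner_J_J: "J v \<bullet> J w = v \<bullet> w"
  by (simp add: J_def inner_vec_def sum_2)

lemma inner_J_self: "v \<bullet> J v = 0" "J v \<bullet> v = 0"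
  by (simp_all add: J_def inner_vec_def sum_2)

lemma frame_expansion:
  assumes "norm n = 1"
  shows "v = (v \<bullet> n) *\<^sub>R n + (v \<bullet> J n) *\<^sub>R J n"
proof -
  have "(n $ 1)\<^sup>2 + (n $ 2)\<^sup>2 = 1"
    using assms by (simp add: norm_eq_1 inner_vec_def sum_2 power2_eq_square)
  then have *: "a = a * ((n $ 1)\<^sup>2 + (n $ 2)\<^sup>2)" for a by simp
  show ?thesis
    unfolding vec_eq_iff forall_2
    by (subst *[of "v $ 1"], subst *[of "v $ 2"])
      (simp add: J_def inner_vec_def sum_2 algebra_simps power2_eq_square)
qed

text \<open>The converse of the Frenet equations. Smoothness of the curve is a consequence of the third one, whose
right-hand side is smooth.\<close>

lemma frontal_curvatureI:
  assumes "open I" "smooth_on I n" "smooth_on I b" "\<And>t. t \<in> I \<Longrightarrow> norm (n t) = 1"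
    and n': "\<And>t. t \<in> I \<Longrightarrow> (n has_vector_derivative l t *\<^sub>R J (n t)) (at t)"
    and g': "\<And>t. t \<in> I \<Longrightarrow> (g has_vector_derivative b t *\<^sub>R J (n t)) (at t)"
  shows "frontal_curvature I g n l b"
proof -
  have "smooth_on I g"
    using assms by (intro smooth_on_antiderivative[OF _ _ g'] smooth_on_intros) auto
  moreover have "n t \<bullet> n t = 1" if "t \<in> I" for t
    using assms(4) that by (simp add: norm_eq_1)
  ultimately show ?thesis
    unfolding frontal_curvature_def frontal_def
    using assms vector_derivative_at[OF n'] vector_derivative_at[OF g']
    by (simp add: inner_J_self inner_J_J)
qed

text \<open>Since \<open>n \<bullet> n = 1\<close>, the derivative of \<open>n\<close> has no component along \<open>n\<close>; its component along \<open>J n\<close> is \<open>l\<close> by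
definition. These are the Frenet equations.\<close>

lemma frontal_curvature_frenet:
  assumes "open I" "frontal_curvature I g n l b" "t \<in> I"
  shows "norm (n t) = 1"
    and "(g has_vector_derivative b t *\<^sub>R J (n t)) (at t)"
    and "(n has_vector_derivative l t *\<^sub>R J (n t)) (at t)"
    and "((\<lambda>t. J (n t)) has_vector_derivative - l t *\<^sub>R n t) (at t)"
proof -
  have smooth: "smooth_on I g" "smooth_on I n" and unit: "\<And>t. t \<in> I \<Longrightarrow> norm (n t) = 1"
    and g': "vector_derivative g (at t) = b t *\<^sub>R J (n t)"
    and l: "l t = vector_derivative n (at t) \<bullet> J (n t)"
    using assms unfolding frontal_curvature_def frontal_def by auto
  show "norm (n t) = 1" using unit assms(3) .
  show "(g has_vector_derivative b t *\<^sub>R J (n t)) (at t)"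
    using smooth_on_has_vector_derivative[OF smooth(1) assms(3)] g' by simp
  note dn = smooth_on_has_vector_derivative[OF smooth(2) assms(3)]
  let ?n' = "vector_derivative n (at t)"
  have "((\<lambda>t. n t \<bullet> n t) has_vector_derivative n t \<bullet> ?n' + ?n' \<bullet> n t) (at t)"
    by (rule bounded_bilinear.has_vector_derivative[OF bounded_bilinear_inner dn dn])
  moreover have "((\<lambda>t. n t \<bullet> n t) has_vector_derivative 0) (at t)"
    by (rule has_vector_derivative_transform_within_open[of "\<lambda>t. 1" _ _ I])
      (use assms unit in \<open>auto simp: norm_eq_1\<close>)
  ultimately have "n t \<bullet> ?n' + ?n' \<bullet> n t = 0" by (rule vector_derivative_unique_at)
  then have "?n' = l t *\<^sub>R J (n t)"
    using frame_expansion[OF unit[OF assms(3)], of ?n'] l by (simp add: inner_commute)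
  with dn show n': "(n has_vector_derivative l t *\<^sub>R J (n t)) (at t)" by simp
  from has_vector_derivative_J[OF n']
  show "((\<lambda>t. J (n t)) has_vector_derivative - l t *\<^sub>R n t) (at t)"
    by (simp add: J_linear_simps J_J)
qed

lemma frontal_curvature_smooth:
  assumes "open I" "frontal_curvature I g n l b"
  shows "smooth_on I g" "smooth_on I n" "smooth_on I b" "smooth_on I l"
proof -
  show n: "smooth_on I g" "smooth_on I n" "smooth_on I b"
    using assms unfolding frontal_curvature_def frontal_def by auto
  have "smooth_on I (\<lambda>t. vector_derivative n (at t) \<bullet> J (n t))"
    using assms n by (intro smooth_on_intros smooth_on_vector_derivative)
  then show "smooth_on I l"
    using assms by (elim smooth_on_cong[rotated]) (auto simp: frontal_curvature_def)
qed

section \<open>Envelopes of circle families as frontals\<close>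

text \<open>Since \<open>J m = cos \<theta> n + s sin \<theta> J n\<close>, the Frenet equations give \<open>m' = (l + s \<theta>') J m\<close>. In
\<open>f' = b J n + r' m + r m'\<close> the first two terms add up to \<open>b (J n + cos \<theta> m)\<close>. As \<open>J n \<bullet> m = - cos \<theta>\<close>, this is
\<open>b\<close> times the projection of \<open>J n\<close> to the direction \<open>J m\<close>, that is, \<open>s b sin \<theta> J m\<close>.\<close>

lemma envelope_frontal_curvature:
  assumes I: "open I" and c: "frontal_curvature I c n l b"
    and r: "smooth_on I r" and \<theta>: "smooth_on I \<theta>" and s: "s * s = (1::real)"
    and r': "\<And>t. t \<in> I \<Longrightarrow> (r has_real_derivative cos (\<theta> t) * b t) (at t)"
    and m: "\<And>t. t \<in> I \<Longrightarrow> m t = - cos (\<theta> t) *\<^sub>R J (n t) + (s * sin (\<theta> t)) *\<^sub>R n t"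
    and f: "\<And>t. t \<in> I \<Longrightarrow> f t = c t + r t *\<^sub>R m t"
  shows "frontal_curvature I f m
    (\<lambda>t. l t + s * deriv \<theta> t) (\<lambda>t. r t * (l t + s * deriv \<theta> t) + s * (b t * sin (\<theta> t)))"
proof -
  note frenet = frontal_curvature_frenet[OF I c]
  note smooth = frontal_curvature_smooth[OF I c]
  have d\<theta>: "(\<theta> has_real_derivative deriv \<theta> t) (at t)"
    and deriv_\<theta>: "vector_derivative \<theta> (at t) = deriv \<theta> t" if "t \<in> I" for t
  proof -
    have *: "(\<theta> has_real_derivative vector_derivative \<theta> (at t)) (at t)"
      using smooth_on_has_vector_derivative[OF \<theta> that]
      by (simp add: has_real_derivative_iff_has_vector_derivative)
    then show "vector_derivative \<theta> (at t) = deriv \<theta> t" by (simp add: DERIV_imp_deriv)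
    with * show "(\<theta> has_real_derivative deriv \<theta> t) (at t)" by simp
  qed
  have deriv_smooth: "smooth_on I (deriv \<theta>)"
    by (rule smooth_on_cong[OF I smooth_on_vector_derivative[OF \<theta>] deriv_\<theta>])
  have Jm: "J (m t) = cos (\<theta> t) *\<^sub>R n t + (s * sin (\<theta> t)) *\<^sub>R J (n t)" if "t \<in> I" for t
    using m[OF that] by (simp add: J_linear_simps J_J)
  have m': "(m has_vector_derivative (l t + s * deriv \<theta> t) *\<^sub>R J (m t)) (at t)" if t: "t \<in> I" for t
  proof -
    have 1: "((\<lambda>t. - cos (\<theta> t)) has_real_derivative sin (\<theta> t) * deriv \<theta> t) (at t)"
      using DERIV_minus[OF DERIV_chain2[OF DERIV_cos d\<theta>[OF t]]] by simp
    have 2: "((\<lambda>t. s * sin (\<theta> t)) has_real_derivative s * (cos (\<theta> t) * deriv \<theta> t)) (at t)"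
      by (rule DERIV_cmult[OF DERIV_chain2[OF DERIV_sin d\<theta>[OF t]]])
    \<comment> \<open>The factor \<open>s\<^sup>2 = 1\<close> is inserted so that \<open>l + s \<theta>'\<close> can be factored out of both components.\<close>
    have "s * deriv \<theta> t * (s * sin (\<theta> t)) = (s * s) * (sin (\<theta> t) * deriv \<theta> t)" by simp
    then have s2: "sin (\<theta> t) * deriv \<theta> t = s * deriv \<theta> t * (s * sin (\<theta> t))"
      by (simp only: s mult_1)
    have "((\<lambda>t. - cos (\<theta> t) *\<^sub>R J (n t) + (s * sin (\<theta> t)) *\<^sub>R n t) has_vector_derivative
        (l t + s * deriv \<theta> t) *\<^sub>R J (m t)) (at t)"
      using has_vector_derivative_add[OF has_vector_derivative_scaleR[OF 1 frenet(4)[OF t]]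
          has_vector_derivative_scaleR[OF 2 frenet(3)[OF t]]]
      unfolding Jm[OF t] s2 by (simp add: algebra_simps)
    then show ?thesis
      by (rule has_vector_derivative_transform_within_open[OF _ I t]) (simp add: m)
  qed
  have f': "(f has_vector_derivative
      (r t * (l t + s * deriv \<theta> t) + s * (b t * sin (\<theta> t))) *\<^sub>R J (m t)) (at t)" if t: "t \<in> I" for t
  proof -
    have "b t * (s * s * (sin (\<theta> t))\<^sup>2 + (cos (\<theta> t))\<^sup>2) = b t" using s by simp
    then have "b t *\<^sub>R J (n t) = (b t * (s * s * (sin (\<theta> t))\<^sup>2 + (cos (\<theta> t))\<^sup>2)) *\<^sub>R J (n t)" by simp
    then have *: "b t *\<^sub>R J (n t) + (cos (\<theta> t) * b t) *\<^sub>R m t = (s * (b t * sin (\<theta> t))) *\<^sub>R J (m t)"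
      unfolding Jm[OF t] unfolding m[OF t] by (simp add: algebra_simps power2_eq_square)
    have "((\<lambda>t. c t + r t *\<^sub>R m t) has_vector_derivative
      (r t * (l t + s * deriv \<theta> t) + s * (b t * sin (\<theta> t))) *\<^sub>R J (m t)) (at t)"
      using has_vector_derivative_add[OF frenet(2)[OF t] has_vector_derivative_scaleR[OF r'[OF t] m'[OF t]]]
      unfolding scaleR_add_left[of "r t * (l t + s * deriv \<theta> t)"] *[symmetric]
      by (simp add: add.left_commute add.commute)
    then show ?thesis
      by (rule has_vector_derivative_transform_within_open[OF _ I t]) (simp add: f)
  qed
  have "smooth_on I (\<lambda>t. - cos (\<theta> t) *\<^sub>R J (n t) + (s * sin (\<theta> t)) *\<^sub>R n t)"
    using I smooth \<theta> by (intro smooth_on_intros)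
  then have "smooth_on I m" by (rule smooth_on_cong[OF I]) (simp add: m)
  moreover have "smooth_on I (\<lambda>t. r t * (l t + s * deriv \<theta> t) + s * (b t * sin (\<theta> t)))"
    using I smooth \<theta> r deriv_smooth by (intro smooth_on_intros)
  moreover have "norm (m t) = 1" if t: "t \<in> I" for t
  proof -
    have "n t \<bullet> n t = 1" using frenet(1)[OF t] by (simp add: norm_eq_1)
    then have "m t \<bullet> m t = (cos (\<theta> t))\<^sup>2 + s * s * (sin (\<theta> t))\<^sup>2"
      unfolding m[OF t]
      by (simp add: inner_diff_left inner_diff_right inner_J_self inner_J_J power2_eq_square)
    then show ?thesis using s by (simp add: norm_eq_1)
  qed
  ultimately show ?thesis by (rule frontal_curvatureI[OF I _ _ _ m' f'])
qed

text \<open>By the previous lemma \<open>f'\<close> is a multiple of \<open>J m\<close>, hence orthogonal to \<open>f - c = r m\<close>. The radius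
may be negative, as \<open>r cos \<phi>\<close> is for some of the evolutoids.\<close>

lemma envelope_of_angle:
  assumes I: "open I" and c: "frontal_curvature I c n l b"
    and r: "smooth_on I r" and \<theta>: "smooth_on I \<theta>" and s: "s * s = (1::real)"
    and r': "\<And>t. t \<in> I \<Longrightarrow> (r has_real_derivative cos (\<theta> t) * b t) (at t)"
    and f: "\<And>t. t \<in> I \<Longrightarrow>
      f t = c t + r t *\<^sub>R (- cos (\<theta> t) *\<^sub>R J (n t) + (s * sin (\<theta> t)) *\<^sub>R n t)"
  shows "envelope I c r f"
proof -
  define m where "m t = - cos (\<theta> t) *\<^sub>R J (n t) + (s * sin (\<theta> t)) *\<^sub>R n t" for t
  have f_m: "f t = c t + r t *\<^sub>R m t" if "t \<in> I" for t
    using f[OF that] by (simp add: m_def)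
  have fc: "frontal_curvature I f m
      (\<lambda>t. l t + s * deriv \<theta> t) (\<lambda>t. r t * (l t + s * deriv \<theta> t) + s * (b t * sin (\<theta> t)))"
    by (rule envelope_frontal_curvature[OF I c r \<theta> s r' _ f_m]) (simp_all add: m_def)
  note frenet = frontal_curvature_frenet[OF I fc]
  have "f t \<in> circle (c t) (r t) \<and> vector_derivative f (at t) \<bullet> (f t - c t) = 0" if t: "t \<in> I" for t
    using frenet(1)[OF t] vector_derivative_at[OF frenet(2)[OF t]] f_m[OF t]
    by (simp add: circle_def norm_eq_1 inner_J_self power2_eq_square)
  with frontal_curvature_smooth[OF I fc] show ?thesis by (simp add: envelope_def)
qed

lemma envelope_pairI:
  assumes I: "open I" and c: "frontal_curvature I c n l b"
    and r: "smooth_on I r" and \<theta>: "smooth_on I \<theta>" and s: "s \<in> {1, -1::real}"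
    and r': "\<And>t. t \<in> I \<Longrightarrow> (r has_real_derivative cos (\<theta> t) * b t) (at t)"
    and f1: "\<And>t. t \<in> I \<Longrightarrow>
      f1 t = c t + r t *\<^sub>R (- cos (\<theta> t) *\<^sub>R J (n t) + (s * sin (\<theta> t)) *\<^sub>R n t)"
    and f2: "\<And>t. t \<in> I \<Longrightarrow>
      f2 t = c t + r t *\<^sub>R (- cos (\<theta> t) *\<^sub>R J (n t) - (s * sin (\<theta> t)) *\<^sub>R n t)"
  shows "envelope_pair I c n r f1 f2"
proof -
  have s2: "s * s = 1" "- s * - s = 1" using s by auto
  have "envelope I c r f1" by (rule envelope_of_angle[OF I c r \<theta> s2(1) r' f1])
  moreover have "envelope I c r f2"
    by (rule envelope_of_angle[OF I c r \<theta> s2(2) r']) (simp_all add: f2)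
  ultimately show ?thesis
    unfolding envelope_pair_def
    by (intro conjI exI[of _ l] exI[of _ b] exI[of _ \<theta>] bexI[OF _ s] ballI c \<theta> r' f1 f2)
qed

section \<open>Circles through a fixed point\<close>

text \<open>The circle with diameter from \<open>P\<close> to \<open>c t\<close>. With \<open>R = norm (c - P)\<close>, write
\<open>c - P = R (sin \<theta> n + cos \<theta> J n)\<close> for a smooth angle \<open>\<theta>\<close>. The centers have second curvature component
\<open>b / 2\<close>, and \<open>R' = (c - P) \<bullet> c' / R = b cos \<theta>\<close>, so \<open>\<theta>\<close> is the angle of a pair of envelopes of the family
with radius \<open>R / 2\<close>. One of the two choices of sign gives back \<open>P\<close>; the other reflects \<open>P\<close> in the line
through the center with direction \<open>J n\<close>, which doubles the normal component of center minus \<open>P\<close>.\<close>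

lemma thales_envelope_pair:
  assumes I: "open I" "is_interval I" and c: "frontal_curvature I c n l b"
    and P: "P \<notin> c ` I"
    and h: "\<And>t. t \<in> I \<Longrightarrow> h t = P + ((c t - P) \<bullet> n t) *\<^sub>R n t"
  shows "envelope_pair I (\<lambda>t. (c t + P) /\<^sub>R 2) n (\<lambda>t. norm (c t - P) / 2) (\<lambda>t. P) h"
proof -
  note frenet = frontal_curvature_frenet[OF I(1) c]
  note smooth = frontal_curvature_smooth[OF I(1) c]
  have nz: "c t - P \<noteq> 0" if "t \<in> I" for t using P that by auto
  define R where "R t = norm (c t - P)" for t
  define p q where "p t = inverse (R t) * ((c t - P) \<bullet> J (n t))"
    and "q t = inverse (R t) * ((c t - P) \<bullet> n t)" for t
  have R_smooth: "smooth_on I R" "smooth_on I (\<lambda>t. inverse (R t))"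
    unfolding R_def using I smooth nz
    by (auto intro!: smooth_on_norm smooth_on_inverse_norm smooth_on_intros)
  have pq_smooth: "smooth_on I p" "smooth_on I q"
    unfolding p_def q_def using I smooth R_smooth by (auto intro!: smooth_on_intros)
  have R: "R t > 0" if "t \<in> I" for t using nz[OF that] by (simp add: R_def)
  have polar: "c t - P = (R t * q t) *\<^sub>R n t + (R t * p t) *\<^sub>R J (n t)" if "t \<in> I" for t
  proof -
    have *: "R t * (inverse (R t) * x) = x" for x using R[OF that] by simp
    show ?thesis unfolding p_def q_def * by (rule frame_expansion[OF frenet(1)[OF that]])
  qed
  have unit: "(p t)\<^sup>2 + (q t)\<^sup>2 = 1" if t: "t \<in> I" for t
  proof -
    have "n t \<bullet> n t = 1" using frenet(1)[OF t] by (simp add: norm_eq_1)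
    then have "(c t - P) \<bullet> (c t - P) = (R t)\<^sup>2 * ((p t)\<^sup>2 + (q t)\<^sup>2)"
      unfolding polar[OF t]
      by (simp add: inner_add_left inner_add_right inner_J_self inner_J_J power2_eq_square algebra_simps)
    moreover have "(c t - P) \<bullet> (c t - P) = (R t)\<^sup>2" by (simp add: R_def dot_square_norm)
    ultimately show ?thesis using R[OF t] by simp
  qed
  obtain \<theta> where \<theta>: "smooth_on I \<theta>" "\<And>t. t \<in> I \<Longrightarrow> cos (\<theta> t) = p t" "\<And>t. t \<in> I \<Longrightarrow> sin (\<theta> t) = q t"
    using smooth_angle[OF I pq_smooth unit] by blast
  have center: "frontal_curvature I (\<lambda>t. (c t + P) /\<^sub>R 2) n l (\<lambda>t. inverse 2 * b t)"
  proof (rule frontal_curvatureI[OF I(1) smooth(2) _ frenet(1,3)])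
    show "smooth_on I (\<lambda>t. inverse 2 * b t)" using I smooth by (intro smooth_on_intros)
    fix t assume t: "t \<in> I"
    show "((\<lambda>t. (c t + P) /\<^sub>R 2) has_vector_derivative (inverse 2 * b t) *\<^sub>R J (n t)) (at t)"
      using bounded_linear.has_vector_derivative[OF bounded_linear_scaleR_right[of "inverse 2"]
          has_vector_derivative_add[OF frenet(2)[OF t] has_vector_derivative_const[of P]]]
      by simp
  qed
  have radius: "((\<lambda>t. R t / 2) has_real_derivative cos (\<theta> t) * (inverse 2 * b t)) (at t)"
    if t: "t \<in> I" for t
  proof -
    have c': "((\<lambda>t. c t - P) has_vector_derivative b t *\<^sub>R J (n t)) (at t)"
      using has_vector_derivative_diff[OF frenet(2)[OF t] has_vector_derivative_const[of P]] by simp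
    have "((\<lambda>t. (c t - P) \<bullet> (c t - P)) has_real_derivative 2 * b t * ((c t - P) \<bullet> J (n t))) (at t)"
      using bounded_bilinear.has_vector_derivative[OF bounded_bilinear_inner c' c']
      by (simp add: has_real_derivative_iff_has_vector_derivative inner_commute mult.assoc)
    then have "((\<lambda>t. sqrt ((c t - P) \<bullet> (c t - P))) has_real_derivative
        inverse (sqrt ((c t - P) \<bullet> (c t - P))) / 2 * (2 * b t * ((c t - P) \<bullet> J (n t)))) (at t)"
      using nz[OF t] by (intro DERIV_chain2[OF DERIV_real_sqrt]) auto
    then have "(R has_real_derivative inverse (R t) * (b t * ((c t - P) \<bullet> J (n t)))) (at t)"
      by (simp add: R_def[abs_def] norm_eq_sqrt_inner mult.assoc)
    moreover have "u * (v * w) / 2 = u * w * (inverse 2 * v)" for u v w :: real by simp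
    ultimately show ?thesis
      unfolding \<theta>(2)[OF t] p_def using DERIV_cdivide[of R _ t UNIV 2] by metis
  qed
  have c_eq: "c t = P + ((R t * q t) *\<^sub>R n t + (R t * p t) *\<^sub>R J (n t))" if "t \<in> I" for t
    using polar[OF that] by (simp add: algebra_simps)
  have half: "inverse 2 *\<^sub>R P + inverse 2 *\<^sub>R P = P"
    by (simp flip: scaleR_add_left)
  have "envelope_pair I (\<lambda>t. (c t + P) /\<^sub>R 2) n (\<lambda>t. R t / 2) (\<lambda>t. P) h"
  \<comment> \<open>The first envelope is to be \<open>P = center - (c - P) / 2\<close>, so the sign of \<open>n\<close> is negative.\<close>
  proof (rule envelope_pairI[where s = "-1", OF I(1) center _ \<theta>(1) _ radius])
    show "smooth_on I (\<lambda>t. R t / 2)"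
      unfolding divide_inverse using I R_smooth by (intro smooth_on_intros)
    fix t assume t: "t \<in> I"
    have "P $ i = ((c t + P) /\<^sub>R 2 + (R t / 2) *\<^sub>R
        (- cos (\<theta> t) *\<^sub>R J (n t) + (- 1 * sin (\<theta> t)) *\<^sub>R n t)) $ i" for i
      unfolding \<theta>(2,3)[OF t] c_eq[OF t] by (simp add: field_simps)
    then show "P = (c t + P) /\<^sub>R 2 + (R t / 2) *\<^sub>R
        (- cos (\<theta> t) *\<^sub>R J (n t) + (- 1 * sin (\<theta> t)) *\<^sub>R n t)" unfolding vec_eq_iff by blast
    have "(c t - P) \<bullet> n t = R t * q t" using R[OF t] by (simp add: q_def)
    then have ht: "h t = P + (R t * q t) *\<^sub>R n t" using h[OF t] by simp
    have "h t $ i = ((c t + P) /\<^sub>R 2 + (R t / 2) *\<^sub>R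
        (- cos (\<theta> t) *\<^sub>R J (n t) - (- 1 * sin (\<theta> t)) *\<^sub>R n t)) $ i" for i
      unfolding \<theta>(2,3)[OF t] ht unfolding c_eq[OF t] by (simp add: field_simps)
    then show "h t = (c t + P) /\<^sub>R 2 + (R t / 2) *\<^sub>R
        (- cos (\<theta> t) *\<^sub>R J (n t) - (- 1 * sin (\<theta> t)) *\<^sub>R n t)" unfolding vec_eq_iff by blast
  qed simp
  then show ?thesis by (simp add: R_def)
qed

section \<open>Radii with derivative plus or minus the speed of the centers\<close>

text \<open>Where \<open>b \<noteq> 0\<close> and \<open>r' = \<plusminus> b\<close>, the equation \<open>r' = - b (m \<bullet> J n)\<close> forces \<open>m \<bullet> J n = \<plusminus> 1\<close>. This closed condition
extends from a dense subset to \<open>I\<close>, and a continuous function on an interval with values in \<open>{1, -1}\<close> is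
constant. The existence of the smooth field \<open>m\<close> is thus what excludes that the sign of \<open>r' = \<plusminus> b\<close> switches
at a zero of \<open>b\<close>.\<close>

lemma creator_is_tangent:
  assumes I: "open I" "is_interval I" "I \<noteq> {}" and c: "frontal_curvature I c n l b"
    and dense: "I \<subseteq> closure {t \<in> I. b t \<noteq> 0 \<and> (deriv r t = b t \<or> deriv r t = - b t)}"
    and m: "creator I c n b r f m"
  obtains \<sigma> :: real where "\<sigma> \<in> {1, -1}" "\<And>t. t \<in> I \<Longrightarrow> m t = - \<sigma> *\<^sub>R J (n t)"
    "\<And>t. t \<in> I \<Longrightarrow> (r has_real_derivative \<sigma> * b t) (at t)"
proof -
  note frenet = frontal_curvature_frenet[OF I(1) c]
  have unit: "norm (m t) = 1" and r': "(r has_real_derivative - b t * (m t \<bullet> J (n t))) (at t)"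
    if "t \<in> I" for t using m that by (auto simp: creator_def)
  define h where "h t = m t \<bullet> J (n t)" for t
  have "smooth_on I h"
    unfolding h_def using m frontal_curvature_smooth[OF I(1) c] I
    by (intro smooth_on_intros) (auto simp: creator_def)
  then have "isCont h t" if "t \<in> I" for t
    using smooth_on_has_vector_derivative[of I h t] that has_vector_derivative_continuous by blast
  then have cont: "continuous_on I h" by (simp add: continuous_at_imp_continuous_on)
  have "h t \<in> {1, -1}" if "t \<in> I" "b t \<noteq> 0" "deriv r t = b t \<or> deriv r t = - b t" for t
  proof -
    have "b t * h t = b t * 1 \<or> b t * h t = b t * (- 1)"
      using DERIV_imp_deriv[OF r'[OF that(1)]] that(3) by (auto simp: h_def)
    with that(2) show ?thesis by (simp only: mult_cancel_left) simp
  qed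
  then have sub: "{t \<in> I. b t \<noteq> 0 \<and> (deriv r t = b t \<or> deriv r t = - b t)} \<subseteq> {t \<in> I. h t \<in> {1, -1}}"
    by blast
  have "closedin (top_of_set I) {t \<in> I. h t \<in> {1, -1}}"
    using continuous_closedin_preimage[OF cont, of "{1, -1}"]
    by (simp add: vimage_def Int_def)
  then obtain C where "closed C" and C: "{t \<in> I. h t \<in> {1, -1}} = I \<inter> C"
    unfolding closedin_closed by blast
  with sub have "closure {t \<in> I. b t \<noteq> 0 \<and> (deriv r t = b t \<or> deriv r t = - b t)} \<subseteq> C"
    by (intro closure_minimal) auto
  with dense C have h: "h t \<in> {1, -1}" if "t \<in> I" for t using that by blast
  then have "h ` I \<subseteq> {1, -1}" by blast
  then have "finite (h ` I)" by (rule finite_subset) simp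
  moreover have "connected I" using I(2) by (simp add: is_interval_connected)
  ultimately have "h constant_on I" using continuous_finite_range_constant[OF _ cont] by blast
  then obtain y where y: "\<And>t. t \<in> I \<Longrightarrow> h t = y" unfolding constant_on_def by blast
  obtain t0 where "t0 \<in> I" using I(3) by blast
  with h y have y1: "y \<in> {1, -1}" by metis
  show ?thesis
  proof (rule that[of "- y"])
    show "- y \<in> {1, -1}" using y1 by auto
    fix t assume t: "t \<in> I"
    show "(r has_real_derivative - y * b t) (at t)"
      using r'[OF t] y[OF t] by (simp add: h_def mult.commute)
    have n: "n t \<bullet> n t = 1" using frenet(1)[OF t] by (simp add: norm_eq_1)
    \<comment> \<open>Two unit vectors with inner product \<open>y = \<plusminus> 1\<close> differ by the factor \<open>y\<close>.\<close>
    have "y * y = 1" using y1 by auto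
    then have "(m t - y *\<^sub>R J (n t)) \<bullet> (m t - y *\<^sub>R J (n t)) = 0"
      using unit[OF t] n y[OF t]
      by (simp add: inner_diff_left inner_diff_right inner_J_J norm_eq_1 h_def inner_commute)
    then show "m t = - (- y) *\<^sub>R J (n t)" by simp
  qed
qed

text \<open>Used to insert \<open>cos\<^sup>2 + sin\<^sup>2 = 1\<close> into the coefficient of a single vector. The two terms are kept as separate
vectors, since simplification would otherwise restore the 1.\<close>

lemma scaleR_cos_sin_split:
  "(x::real) *\<^sub>R (v::'a::real_vector) = (x * cos \<phi> * cos \<phi>) *\<^sub>R v + (x * sin \<phi> * sin \<phi>) *\<^sub>R v"
proof -
  have "x * cos \<phi> * cos \<phi> + x * sin \<phi> * sin \<phi> = x * ((cos \<phi>)\<^sup>2 + (sin \<phi>)\<^sup>2)"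
    by (simp only: power2_eq_square algebra_simps)
  then show ?thesis by (simp flip: scaleR_add_left)
qed

text \<open>The curve is \<open>c + \<sigma> r sin \<phi> N\<close> with \<open>N = cos \<phi> n - sin \<phi> J n\<close>, the Gauss mapping \<open>n\<close> turned by the constant
angle \<open>- \<phi>\<close>, so that \<open>N' = l J N\<close>. Because \<open>\<sigma> r' = b\<close>, the \<open>N\<close>-component \<open>- b sin \<phi>\<close> of \<open>c'\<close> cancels, and
\<open>N\<close> is a Gauss mapping of the new curve.\<close>

lemma pedaloid_base_frontal:
  assumes I: "open I" and c: "frontal_curvature I c n l b"
    and r: "smooth_on I r" and \<sigma>: "\<sigma> * \<sigma> = (1::real)"
    and r': "\<And>t. t \<in> I \<Longrightarrow> (r has_real_derivative \<sigma> * b t) (at t)"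
  shows "frontal_curvature I (pedaloid_base \<sigma> c n r \<phi>) (\<lambda>t. cos \<phi> *\<^sub>R n t - sin \<phi> *\<^sub>R J (n t)) l
    (\<lambda>t. cos \<phi> * b t + (\<sigma> * sin \<phi>) * (r t * l t))"
proof -
  note frenet = frontal_curvature_frenet[OF I c]
  note smooth = frontal_curvature_smooth[OF I c]
  define N where "N t = cos \<phi> *\<^sub>R n t - sin \<phi> *\<^sub>R J (n t)" for t
  have JN: "J (N t) = cos \<phi> *\<^sub>R J (n t) + sin \<phi> *\<^sub>R n t" for t
    by (simp add: N_def J_linear_simps J_J)
  have N': "(N has_vector_derivative l t *\<^sub>R J (N t)) (at t)" if t: "t \<in> I" for t
    using has_vector_derivative_diff[OF
        bounded_linear.has_vector_derivative[OF bounded_linear_scaleR_right[of "cos \<phi>"] frenet(3)[OF t]]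
        bounded_linear.has_vector_derivative[OF bounded_linear_scaleR_right[of "sin \<phi>"] frenet(4)[OF t]]]
    by (simp add: N_def[abs_def] J_linear_simps J_J algebra_simps)
  have base: "pedaloid_base \<sigma> c n r \<phi> = (\<lambda>t. c t + (\<sigma> * sin \<phi> * r t) *\<^sub>R N t)"
    by (simp add: fun_eq_iff pedaloid_base_def N_def algebra_simps)
  have "frontal_curvature I (pedaloid_base \<sigma> c n r \<phi>) N l
    (\<lambda>t. cos \<phi> * b t + (\<sigma> * sin \<phi>) * (r t * l t))"
  proof (rule frontal_curvatureI[OF I])
    show "smooth_on I N" unfolding N_def using I smooth by (intro smooth_on_intros)
    show "smooth_on I (\<lambda>t. cos \<phi> * b t + (\<sigma> * sin \<phi>) * (r t * l t))"
      using I smooth r by (intro smooth_on_intros)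
    fix t assume t: "t \<in> I"
    have "n t \<bullet> n t = 1" using frenet(1)[OF t] by (simp add: norm_eq_1)
    then have "N t \<bullet> N t = (cos \<phi>)\<^sup>2 + (sin \<phi>)\<^sup>2"
      by (simp add: N_def inner_diff_left inner_diff_right inner_J_self inner_J_J power2_eq_square)
    then show "norm (N t) = 1" by (simp add: norm_eq_1)
    show "(N has_vector_derivative l t *\<^sub>R J (N t)) (at t)" by (rule N'[OF t])
    have dr: "((\<lambda>t. \<sigma> * sin \<phi> * r t) has_real_derivative sin \<phi> * b t) (at t)"
    proof -
      have "\<sigma> * sin \<phi> * (\<sigma> * b t) = (\<sigma> * \<sigma>) * (sin \<phi> * b t)" by simp
      also have "\<dots> = sin \<phi> * b t" by (simp only: \<sigma> mult_1)
      finally show ?thesis using DERIV_cmult[OF r'[OF t], of "\<sigma> * sin \<phi>"] by metis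
    qed
    have *: "b t *\<^sub>R J (n t) + (sin \<phi> * b t) *\<^sub>R N t = (cos \<phi> * b t) *\<^sub>R J (N t)"
      unfolding JN unfolding N_def scaleR_cos_sin_split[of "b t" "J (n t)" \<phi>] by (simp add: algebra_simps)
    show "(pedaloid_base \<sigma> c n r \<phi> has_vector_derivative
        (cos \<phi> * b t + (\<sigma> * sin \<phi>) * (r t * l t)) *\<^sub>R J (N t)) (at t)"
      using has_vector_derivative_add[OF frenet(2)[OF t] has_vector_derivative_scaleR[OF dr N'[OF t]]]
      unfolding scaleR_add_left *[symmetric] base
      by (simp add: add.left_commute add.commute mult.assoc)
  qed
  then show ?thesis by (simp add: N_def[abs_def])
qed

text \<open>The pedaloid projects orthogonally from \<open>P\<close> to the line through \<open>f\<close> with direction \<open>J N\<close>, where \<open>N\<close> is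
\<open>n\<close> turned by \<open>- \<phi>\<close>; it therefore differs from \<open>P\<close> by the \<open>N\<close>-component of \<open>f - P\<close>. That line also
contains the base curve, which may thus replace \<open>f\<close>.\<close>

lemma pedaloid_via_base:
  assumes n: "norm (n t) = 1" and \<sigma>: "\<sigma> * \<sigma> = (1::real)"
    and f: "f t = c t - (\<sigma> * r t) *\<^sub>R J (n t)" and m: "m t = - \<sigma> *\<^sub>R J (n t)"
  shows "pedaloid f m P \<phi> t =
    P + ((pedaloid_base \<sigma> c n r \<phi> t - P) \<bullet> (cos \<phi> *\<^sub>R n t - sin \<phi> *\<^sub>R J (n t))) *\<^sub>R
      (cos \<phi> *\<^sub>R n t - sin \<phi> *\<^sub>R J (n t))"
proof -
  define N where "N = cos \<phi> *\<^sub>R n t - sin \<phi> *\<^sub>R J (n t)"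
  have n1: "n t \<bullet> n t = 1" using n by (simp add: norm_eq_1)
  have N1: "N \<bullet> N = 1"
    using n1 by (simp add: N_def inner_diff_left inner_diff_right inner_J_self inner_J_J flip: power2_eq_square)
  have dir: "sin \<phi> *\<^sub>R J (m t) - cos \<phi> *\<^sub>R m t = \<sigma> *\<^sub>R J N"
    by (simp add: m N_def J_linear_simps J_J algebra_simps)
  have "pedaloid f m P \<phi> t = f t + (\<sigma> * \<sigma> * ((P - f t) \<bullet> J N)) *\<^sub>R J N"
    unfolding pedaloid_def dir by (simp add: mult.assoc mult.left_commute)
  also have "\<dots> = f t + ((P - f t) \<bullet> J N) *\<^sub>R J N" using \<sigma> by simp
  also have "\<dots> = P - ((P - f t) \<bullet> N) *\<^sub>R N"
    using frame_expansion[of N "P - f t"] N1 by (simp add: norm_eq_1 algebra_simps)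
  also have "\<dots> = P + ((f t - P) \<bullet> N) *\<^sub>R N"
    by (simp add: inner_diff_left algebra_simps)
  also have "(f t - P) \<bullet> N = (pedaloid_base \<sigma> c n r \<phi> t - P) \<bullet> N"
  proof -
    have "pedaloid_base \<sigma> c n r \<phi> t = c t + (\<sigma> * r t * sin \<phi>) *\<^sub>R N"
      by (simp add: pedaloid_base_def N_def algebra_simps)
    moreover have "J (n t) \<bullet> N = - sin \<phi>"
      using n1 by (simp add: N_def inner_diff_right inner_J_self inner_J_J)
    ultimately show ?thesis
      using N1 by (simp add: f inner_diff_left inner_add_left)
  qed
  finally show ?thesis by (simp add: N_def)
qed

lemma pedaloid_envelope_pair:
  assumes I: "open I" "is_interval I" and c: "frontal_curvature I c n l b"
    and r: "smooth_on I r" and \<sigma>: "\<sigma> * \<sigma> = (1::real)"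
    and r': "\<And>t. t \<in> I \<Longrightarrow> (r has_real_derivative \<sigma> * b t) (at t)"
    and f: "\<And>t. t \<in> I \<Longrightarrow> f t = c t - (\<sigma> * r t) *\<^sub>R J (n t)"
    and m: "\<And>t. t \<in> I \<Longrightarrow> m t = - \<sigma> *\<^sub>R J (n t)"
    and P: "P \<notin> pedaloid_base \<sigma> c n r \<phi> ` I"
  shows "envelope_pair I (\<lambda>t. (pedaloid_base \<sigma> c n r \<phi> t + P) /\<^sub>R 2)
    (\<lambda>t. cos \<phi> *\<^sub>R n t - sin \<phi> *\<^sub>R J (n t)) (\<lambda>t. norm (pedaloid_base \<sigma> c n r \<phi> t - P) / 2)
    (\<lambda>t. P) (pedaloid f m P \<phi>)"
proof (rule thales_envelope_pair[OF I pedaloid_base_frontal[OF I(1) c r \<sigma> r'] P])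
  fix t assume t: "t \<in> I"
  show "pedaloid f m P \<phi> t = P + ((pedaloid_base \<sigma> c n r \<phi> t - P) \<bullet> (cos \<phi> *\<^sub>R n t - sin \<phi> *\<^sub>R J (n t))) *\<^sub>R
      (cos \<phi> *\<^sub>R n t - sin \<phi> *\<^sub>R J (n t))"
    using frontal_curvature_frenet(1)[OF I(1) c t] \<sigma> f[OF t] m[OF t] by (rule pedaloid_via_base)
qed

lemma evolutoid_eq_pedaloid_base:
  assumes \<sigma>: "\<sigma> * \<sigma> = (1::real)"
    and f: "f t = c t - (\<sigma> * r t) *\<^sub>R J (n t)" and m: "m t = - \<sigma> *\<^sub>R J (n t)"
  shows "evolutoid f m r (\<phi> + pi / 2) t = pedaloid_base \<sigma> c n r \<phi> t"
proof -
  show ?thesis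
    unfolding evolutoid_def f m pedaloid_base_def scaleR_cos_sin_split[of "\<sigma> * r t" "J (n t)" \<phi>]
    by (simp add: sin_add cos_add J_linear_simps J_J algebra_simps)
qed

text \<open>Expanding in the frame, the evolutoid is \<open>c - \<sigma> r cos \<phi> (cos \<phi> J n + sin \<phi> n)\<close>, and \<open>\<pi> - \<phi>\<close> in place of
\<open>\<phi>\<close> reverses the sign of the normal term.\<close>

lemma evolutoid_envelope_pair:
  assumes I: "open I" and c: "frontal_curvature I c n l b"
    and r: "smooth_on I r" and \<sigma>: "\<sigma> \<in> {1, -1::real}"
    and r': "\<And>t. t \<in> I \<Longrightarrow> (r has_real_derivative \<sigma> * b t) (at t)"
    and f: "\<And>t. t \<in> I \<Longrightarrow> f t = c t - (\<sigma> * r t) *\<^sub>R J (n t)"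
    and m: "\<And>t. t \<in> I \<Longrightarrow> m t = - \<sigma> *\<^sub>R J (n t)"
  shows "envelope_pair I c n (\<lambda>t. cos \<phi> * r t) (evolutoid f m r \<phi>) (evolutoid f m r (pi - \<phi>))"
proof -
  \<comment> \<open>Adding \<open>\<pi>\<close> to the angle absorbs \<open>\<sigma> = -1\<close> in sine and cosine at once.\<close>
  define \<theta>0 where "\<theta>0 = (if \<sigma> = 1 then 0 else pi)"
  have angle: "cos (\<phi> + \<theta>0) = \<sigma> * cos \<phi>" "sin (\<phi> + \<theta>0) = \<sigma> * sin \<phi>"
    using \<sigma> by (auto simp: \<theta>0_def)
  show ?thesis
  proof (rule envelope_pairI[where s = "-1" and \<theta> = "\<lambda>t. \<phi> + \<theta>0", OF I c])
    show "smooth_on I (\<lambda>t. cos \<phi> * r t)" using I r by (intro smooth_on_intros)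
    show "smooth_on I (\<lambda>t. \<phi> + \<theta>0)" by (rule smooth_on_const[OF I])
    show "(-1::real) \<in> {1, -1}" by simp
    fix t assume t: "t \<in> I"
    show "((\<lambda>t. cos \<phi> * r t) has_real_derivative cos (\<phi> + \<theta>0) * b t) (at t)"
      using DERIV_cmult[OF r'[OF t], of "cos \<phi>"] by (simp add: angle mult.assoc mult.left_commute)
    note ft = f[OF t, unfolded scaleR_cos_sin_split[of "\<sigma> * r t" "J (n t)" \<phi>]]
    show "evolutoid f m r \<phi> t = c t + (cos \<phi> * r t) *\<^sub>R
        (- cos (\<phi> + \<theta>0) *\<^sub>R J (n t) + (- 1 * sin (\<phi> + \<theta>0)) *\<^sub>R n t)"
      unfolding evolutoid_def angle ft m[OF t]
      by (simp add: J_linear_simps J_J algebra_simps)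
    show "evolutoid f m r (pi - \<phi>) t = c t + (cos \<phi> * r t) *\<^sub>R
        (- cos (\<phi> + \<theta>0) *\<^sub>R J (n t) - (- 1 * sin (\<phi> + \<theta>0)) *\<^sub>R n t)"
      unfolding evolutoid_def angle ft m[OF t]
      by (simp add: J_linear_simps J_J algebra_simps)
  qed
qed

section \<open>Pairs with a constant envelope\<close>

text \<open>As \<open>f1\<close> is constant, \<open>2 c - f1\<close> has derivative \<open>2 c'\<close>, so \<open>n\<close> remains a Gauss mapping. The vector from
\<open>2 c - f1\<close> to \<open>f1\<close> is \<open>2 (f1 - c)\<close>; adding its \<open>J n\<close>-component to \<open>2 c - f1\<close> gives
\<open>c - (f1 - c) + 2 ((f1 - c) \<bullet> J n) J n\<close>, in which the \<open>n\<close>-component of \<open>f1 - c\<close> is reversed and the other one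
kept. This is \<open>f2\<close>.\<close>

lemma antipode_of_fixed_point_is_pedal:
  assumes I: "open I" and c: "frontal_curvature I c n l b"
    and pair: "envelope_pair I c n r f1 f2" and P: "\<And>t. t \<in> I \<Longrightarrow> f1 t = P"
  shows "frontal I (\<lambda>t. 2 *\<^sub>R c t - f1 t) n"
    and "\<And>t. t \<in> I \<Longrightarrow> f2 t = pedal (\<lambda>t. 2 *\<^sub>R c t - f1 t) n P t"
proof -
  note frenet = frontal_curvature_frenet[OF I c]
  note smooth = frontal_curvature_smooth[OF I c]
  have "((\<lambda>t. 2 *\<^sub>R c t - f1 t) has_vector_derivative (2 * b t) *\<^sub>R J (n t)) (at t)" if t: "t \<in> I" for t
  proof -
    have "(f1 has_vector_derivative 0) (at t)"
      by (rule has_vector_derivative_transform_within_open[of "\<lambda>t. P" _ _ I]) (use I t P in auto)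
    from has_vector_derivative_diff[OF bounded_linear.has_vector_derivative[OF
        bounded_linear_scaleR_right[of 2] frenet(2)[OF t]] this]
    show ?thesis by simp
  qed
  moreover have "smooth_on I (\<lambda>t. 2 * b t)" using I smooth by (intro smooth_on_intros)
  ultimately have "frontal_curvature I (\<lambda>t. 2 *\<^sub>R c t - f1 t) n l (\<lambda>t. 2 * b t)"
    by (intro frontal_curvatureI[OF I smooth(2) _ frenet(1,3)])
  then show "frontal I (\<lambda>t. 2 *\<^sub>R c t - f1 t) n" by (simp add: frontal_curvature_def)
  fix t assume t: "t \<in> I"
  obtain \<theta> s where f: "f1 t = c t + r t *\<^sub>R (- cos \<theta> *\<^sub>R J (n t) + (s * sin \<theta>) *\<^sub>R n t)"
      "f2 t = c t + r t *\<^sub>R (- cos \<theta> *\<^sub>R J (n t) - (s * sin \<theta>) *\<^sub>R n t)"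
    using pair t unfolding envelope_pair_def by blast
  have n1: "n t \<bullet> n t = 1" using frenet(1)[OF t] by (simp add: norm_eq_1)
  have "P - (2 *\<^sub>R c t - f1 t) = (2 * r t) *\<^sub>R (- cos \<theta> *\<^sub>R J (n t) + (s * sin \<theta>) *\<^sub>R n t)"
    unfolding P[OF t, symmetric] f vec_eq_iff by (simp add: algebra_simps)
  then have "(P - (2 *\<^sub>R c t - f1 t)) \<bullet> J (n t) = - 2 * r t * cos \<theta>"
    using n1 by (simp add: inner_diff_left inner_J_self inner_J_J)
  then have "pedal (\<lambda>t. 2 *\<^sub>R c t - f1 t) n P t = 2 *\<^sub>R c t - f1 t + (- 2 * r t * cos \<theta>) *\<^sub>R J (n t)"
    by (simp add: pedal_def pedaloid_def)
  also have "\<dots> = f2 t"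
    unfolding f vec_eq_iff by (simp add: algebra_simps)
  finally show "f2 t = pedal (\<lambda>t. 2 *\<^sub>R c t - f1 t) n P t" by simp
qed

section \<open>Evolutes, evolutoids and pedaloids of envelopes\<close>

theorem theorem2:
  fixes I :: "real set"
    and \<gamma> \<nu> :: "real \<Rightarrow> real^2"
    and l \<beta> lam :: "real \<Rightarrow> real"
  assumes I: "open I" "is_interval I" "I \<noteq> {}"
    and \<gamma>: "frontal_curvature I \<gamma> \<nu> l \<beta>"
    and lam: "smooth_on I lam" "\<forall>t\<in>I. lam t > 0"
  shows
    "(\<forall>f \<nu>t \<theta>. \<forall>s\<in>{1, -1::real}.
        envelope I \<gamma> lam f \<and> creator I \<gamma> \<nu> \<beta> lam f \<nu>t \<and> smooth_on I \<theta> \<and>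
        (\<forall>t\<in>I. (lam has_real_derivative cos (\<theta> t) * \<beta> t) (at t)) \<and>
        (\<forall>t\<in>I. \<nu>t t = - cos (\<theta> t) *\<^sub>R J (\<nu> t) + (s * sin (\<theta> t)) *\<^sub>R \<nu> t) \<longrightarrow>
        frontal I f \<nu>t \<and>
        frontal_curvature I f \<nu>t
          (\<lambda>t. l t + s * deriv \<theta> t)
          (\<lambda>t. lam t * (l t + s * deriv \<theta> t) + s * (\<beta> t * sin (\<theta> t)))) \<and>

     (\<forall>f \<nu>t.
        I \<subseteq> closure {t \<in> I. \<beta> t \<noteq> 0 \<and> (deriv lam t = \<beta> t \<or> deriv lam t = - \<beta> t)} \<and>
        envelope I \<gamma> lam f \<and>
        (\<forall>g. envelope I \<gamma> lam g \<longrightarrow> (\<forall>t\<in>I. g t = f t)) \<and>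
        creator I \<gamma> \<nu> \<beta> lam f \<nu>t \<longrightarrow>
        (evolute_function I f \<nu>t lam \<and> (\<forall>t\<in>I. \<gamma> t = evolute f \<nu>t lam t)) \<and>
        (\<forall>\<phi>. \<phi> \<notin> {pi / 2 + of_int k * pi | k. True} \<longrightarrow>
           envelope_pair I \<gamma> \<nu> (\<lambda>t. cos \<phi> * lam t)
             (evolutoid f \<nu>t lam \<phi>) (evolutoid f \<nu>t lam (pi - \<phi>))) \<and>
        (\<forall>P. P \<notin> \<gamma> ` I \<longrightarrow>
           envelope_pair I (\<lambda>t. (\<gamma> t + P) /\<^sub>R 2) \<nu> (\<lambda>t. norm ((\<gamma> t - P) /\<^sub>R 2))
             (\<lambda>t. P) (contrapedal f \<nu>t P)) \<and>
        (\<exists>\<sigma>\<in>{1, -1}. (\<forall>t\<in>I. deriv lam t = \<sigma> * \<beta> t) \<and>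
           (\<forall>\<phi> P. P \<notin> evolutoid f \<nu>t lam (\<phi> + pi / 2) ` I \<longrightarrow>
              envelope_pair I
                (\<lambda>t. (pedaloid_base \<sigma> \<gamma> \<nu> lam \<phi> t + P) /\<^sub>R 2)
                (\<lambda>t. cos \<phi> *\<^sub>R \<nu> t - sin \<phi> *\<^sub>R J (\<nu> t))
                (\<lambda>t. norm (pedaloid_base \<sigma> \<gamma> \<nu> lam \<phi> t - P) / 2)
                (\<lambda>t. P) (pedaloid f \<nu>t P \<phi>)))) \<and>

     (\<forall>f1 f2 P.
        I \<subseteq> closure {t \<in> I. \<beta> t \<noteq> 0 \<and> \<bar>deriv lam t\<bar> \<le> \<bar>\<beta> t\<bar>} \<and>
        envelope_pair I \<gamma> \<nu> lam f1 f2 \<and> (\<forall>t\<in>I. f1 t = P) \<longrightarrow>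
        frontal I (\<lambda>t. 2 *\<^sub>R \<gamma> t - f1 t) \<nu> \<and>
        (\<forall>t\<in>I. f2 t = pedal (\<lambda>t. 2 *\<^sub>R \<gamma> t - f1 t) \<nu> P t))"
proof (intro conjI allI ballI impI)
  fix f \<nu>t \<theta> and s :: real
  assume s: "s \<in> {1, -1}" and A: "envelope I \<gamma> lam f \<and> creator I \<gamma> \<nu> \<beta> lam f \<nu>t \<and> smooth_on I \<theta> \<and>
    (\<forall>t\<in>I. (lam has_real_derivative cos (\<theta> t) * \<beta> t) (at t)) \<and>
    (\<forall>t\<in>I. \<nu>t t = - cos (\<theta> t) *\<^sub>R J (\<nu> t) + (s * sin (\<theta> t)) *\<^sub>R \<nu> t)"
  show fc: "frontal_curvature I f \<nu>t (\<lambda>t. l t + s * deriv \<theta> t)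
      (\<lambda>t. lam t * (l t + s * deriv \<theta> t) + s * (\<beta> t * sin (\<theta> t)))"
    by (rule envelope_frontal_curvature[OF I(1) \<gamma> lam(1)])
      (use A s in \<open>auto simp: creator_def\<close>)
  then show "frontal I f \<nu>t" by (simp add: frontal_curvature_def)
next
  fix f \<nu>t
  assume A: "I \<subseteq> closure {t \<in> I. \<beta> t \<noteq> 0 \<and> (deriv lam t = \<beta> t \<or> deriv lam t = - \<beta> t)} \<and>
    envelope I \<gamma> lam f \<and> (\<forall>g. envelope I \<gamma> lam g \<longrightarrow> (\<forall>t\<in>I. g t = f t)) \<and>
    creator I \<gamma> \<nu> \<beta> lam f \<nu>t"
  then have dense: "I \<subseteq> closure {t \<in> I. \<beta> t \<noteq> 0 \<and> (deriv lam t = \<beta> t \<or> deriv lam t = - \<beta> t)}"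
    and creator: "creator I \<gamma> \<nu> \<beta> lam f \<nu>t" by blast+
  obtain \<sigma> where \<sigma>: "\<sigma> \<in> {1, -1}" and m: "\<And>t. t \<in> I \<Longrightarrow> \<nu>t t = - \<sigma> *\<^sub>R J (\<nu> t)"
    and lam': "\<And>t. t \<in> I \<Longrightarrow> (lam has_real_derivative \<sigma> * \<beta> t) (at t)"
    by (rule creator_is_tangent[OF I \<gamma> dense creator]) (rule that)
  have \<sigma>2: "\<sigma> * \<sigma> = 1" using \<sigma> by auto
  have f_creator: "f t = \<gamma> t + lam t *\<^sub>R \<nu>t t" if "t \<in> I" for t
    using creator that by (simp add: creator_def)
  then have f: "f t = \<gamma> t - (\<sigma> * lam t) *\<^sub>R J (\<nu> t)" if "t \<in> I" for t
    using m[OF that] that by (simp add: mult.commute)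
  have pedaloids: "envelope_pair I (\<lambda>t. (pedaloid_base \<sigma> \<gamma> \<nu> lam \<phi> t + P) /\<^sub>R 2)
      (\<lambda>t. cos \<phi> *\<^sub>R \<nu> t - sin \<phi> *\<^sub>R J (\<nu> t))
      (\<lambda>t. norm (pedaloid_base \<sigma> \<gamma> \<nu> lam \<phi> t - P) / 2) (\<lambda>t. P) (pedaloid f \<nu>t P \<phi>)"
    if "P \<notin> pedaloid_base \<sigma> \<gamma> \<nu> lam \<phi> ` I" for P \<phi>
    by (rule pedaloid_envelope_pair[OF I(1,2) \<gamma> lam(1) \<sigma>2 lam' f m that])

  \<comment> \<open>The creator \<open>- \<sigma> J \<nu>\<close> is the one for the constant angle 0 or \<open>\<pi>\<close>.\<close>
  define \<theta>0 where "\<theta>0 = (if \<sigma> = 1 then 0 else pi)"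
  have angle: "cos \<theta>0 = \<sigma>" "sin \<theta>0 = 0" using \<sigma> by (auto simp: \<theta>0_def)
  have "frontal_curvature I f \<nu>t (\<lambda>t. l t + 1 * deriv (\<lambda>t. \<theta>0) t)
      (\<lambda>t. lam t * (l t + 1 * deriv (\<lambda>t. \<theta>0) t) + 1 * (\<beta> t * sin \<theta>0))"
    by (rule envelope_frontal_curvature[OF I(1) \<gamma> lam(1) smooth_on_const[OF I(1)]])
      (simp_all add: angle m lam' f_creator)
  then have "frontal_curvature I f \<nu>t l (\<lambda>t. lam t * l t)" by (simp add: angle)
  then show "evolute_function I f \<nu>t lam"
    unfolding evolute_function_def using lam(1)
    by (intro conjI exI[of _ l] exI[of _ "\<lambda>t. lam t * l t"] ballI) (simp_all add: mult.commute)
  show "\<gamma> t = evolute f \<nu>t lam t" if "t \<in> I" for t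
    using f_creator[OF that] by (simp add: evolute_def)
  show "envelope_pair I \<gamma> \<nu> (\<lambda>t. cos \<phi> * lam t) (evolutoid f \<nu>t lam \<phi>) (evolutoid f \<nu>t lam (pi - \<phi>))" for \<phi>
    by (rule evolutoid_envelope_pair[OF I(1) \<gamma> lam(1) \<sigma> lam' f m])
  \<comment> \<open>The contrapedal is the pedaloid of angle 0, whose base curve is \<open>\<gamma>\<close> itself.\<close>
  have base0: "pedaloid_base \<sigma> \<gamma> \<nu> lam 0 = \<gamma>" by (simp add: fun_eq_iff pedaloid_base_def)
  show "envelope_pair I (\<lambda>t. (\<gamma> t + P) /\<^sub>R 2) \<nu> (\<lambda>t. norm ((\<gamma> t - P) /\<^sub>R 2))
      (\<lambda>t. P) (contrapedal f \<nu>t P)" if P: "P \<notin> \<gamma> ` I" for P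
  proof -
    have radius: "norm (v /\<^sub>R 2) = norm v / 2" for v :: "real^2" by simp
    have frame0: "cos 0 *\<^sub>R \<nu> t - sin 0 *\<^sub>R J (\<nu> t) = \<nu> t" for t by simp
    show ?thesis
      unfolding contrapedal_def radius by (rule pedaloids[of P 0, unfolded base0 frame0, OF P])
  qed
  show "\<exists>\<sigma>\<in>{1, -1}. (\<forall>t\<in>I. deriv lam t = \<sigma> * \<beta> t) \<and>
      (\<forall>\<phi> P. P \<notin> evolutoid f \<nu>t lam (\<phi> + pi / 2) ` I \<longrightarrow>
        envelope_pair I (\<lambda>t. (pedaloid_base \<sigma> \<gamma> \<nu> lam \<phi> t + P) /\<^sub>R 2)
          (\<lambda>t. cos \<phi> *\<^sub>R \<nu> t - sin \<phi> *\<^sub>R J (\<nu> t))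
          (\<lambda>t. norm (pedaloid_base \<sigma> \<gamma> \<nu> lam \<phi> t - P) / 2) (\<lambda>t. P) (pedaloid f \<nu>t P \<phi>))"
  proof (rule bexI[OF _ \<sigma>], intro conjI allI impI ballI)
    show "deriv lam t = \<sigma> * \<beta> t" if "t \<in> I" for t by (rule DERIV_imp_deriv[OF lam'[OF that]])
    fix \<phi> P assume "P \<notin> evolutoid f \<nu>t lam (\<phi> + pi / 2) ` I"
    moreover have "evolutoid f \<nu>t lam (\<phi> + pi / 2) ` I = pedaloid_base \<sigma> \<gamma> \<nu> lam \<phi> ` I"
      by (intro image_cong refl evolutoid_eq_pedaloid_base[OF \<sigma>2] f m)
    ultimately have "P \<notin> pedaloid_base \<sigma> \<gamma> \<nu> lam \<phi> ` I" by simp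
    then show "envelope_pair I (\<lambda>t. (pedaloid_base \<sigma> \<gamma> \<nu> lam \<phi> t + P) /\<^sub>R 2)
          (\<lambda>t. cos \<phi> *\<^sub>R \<nu> t - sin \<phi> *\<^sub>R J (\<nu> t))
          (\<lambda>t. norm (pedaloid_base \<sigma> \<gamma> \<nu> lam \<phi> t - P) / 2) (\<lambda>t. P) (pedaloid f \<nu>t P \<phi>)"
      by (rule pedaloids)
  qed
next
  fix f1 f2 P
  assume A: "I \<subseteq> closure {t \<in> I. \<beta> t \<noteq> 0 \<and> \<bar>deriv lam t\<bar> \<le> \<bar>\<beta> t\<bar>} \<and>
    envelope_pair I \<gamma> \<nu> lam f1 f2 \<and> (\<forall>t\<in>I. f1 t = P)"
  then have pair: "envelope_pair I \<gamma> \<nu> lam f1 f2" and P: "\<And>t. t \<in> I \<Longrightarrow> f1 t = P" by auto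
  show "frontal I (\<lambda>t. 2 *\<^sub>R \<gamma> t - f1 t) \<nu>"
    by (rule antipode_of_fixed_point_is_pedal(1)[OF I(1) \<gamma> pair P])
  show "f2 t = pedal (\<lambda>t. 2 *\<^sub>R \<gamma> t - f1 t) \<nu> P t" if "t \<in> I" for t
    by (rule antipode_of_fixed_point_is_pedal(2)[OF I(1) \<gamma> pair P that])
qed

end
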